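(* For any odd integer $r\geqslant 3$ and any $r$-admissible $6$-tuple $(n_1,n_2,n_3,n_4,n_5,n_6)$, $$\frac{2\pi}{r}\log\left|\;\begin{vmatrix} n_1&n_2&n_3\\ n_4&n_5&n_6\end{vmatrix}_{q=e^{\frac{2\pi i}{r}}}\right|\leqslant v_8+O\left(\frac{\log r}{r}\right),$$ where the $O$-term is uniform: there exist constants $C,r_0$ independent of $r$ and of the $6$-tuple such that the error term is at most $C\frac{\log r}{r}$ whenever $r>r_0$.
   Context: $v_8\cong3.66$ is the volume of the regular ideal hyperbolic octahedron; convention $\log 0=-\infty$. Let $r\geqslant 3$ be odd, $q=e^{2\pi i/r}$, $\{n\}=q^n-q^{-n}$, $\{n\}!=\prod_{i=1}^n\{i\}$, $\{0\}!=1$, $\zeta_r=2\sin(2\pi/r)=-\sqrt{-1}\{1\}$. A triple $(a,b,c)$ of non-negative integers is $r$-admissible if $a,b,c\leqslant r-2$; $a+b+c$ is even and $\leqslant 2r-4$; and $a\leqslant b+c$, $b\leqslant a+c$, $c\leqslant a+b$. A 6-tuple $(n_1,\dots,n_6)$ is $r$-admissible if the triples $v_1=(n_1,n_2,n_3)$, $v_2=(n_1,n_5,n_6)$, $v_3=(n_2,n_4,n_6)$, $v_4=(n_3,n_4,n_5)$ are $r$-admissible. For an $r$-admissible triple, $$\Delta(a,b,c)=\left(\sqrt{-1}\,\zeta_r\frac{\{\frac{a+b-c}{2}\}!\{\frac{a-b+c}{2}\}!\{\frac{-a+b+c}{2}\}!}{\{\frac{a+b+c}{2}+1\}!}\right)^{1/2}$$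 (the number inside is real; take the positive root of a positive number and the root with positive imaginary part of a negative number). The quantum $6j$-symbol of an $r$-admissible 6-tuple is $$\begin{vmatrix} n_1&n_2&n_3\\ n_4&n_5&n_6\end{vmatrix}=\zeta_r^{-1}(\sqrt{-1})^{\lambda}\prod_{i=1}^4\Delta(v_i)\sum_{z=\max T_i}^{\min Q_j}\frac{(-1)^z\{z+1\}!}{\prod_{i=1}^4\{z-T_i\}!\prod_{j=1}^3\{Q_j-z\}!},$$ where $\lambda=\sum_{i=1}^6 n_i$, $T_1=\frac{n_1+n_2+n_3}{2}$, $T_2=\frac{n_1+n_5+n_6}{2}$, $T_3=\frac{n_2+n_4+n_6}{2}$, $T_4=\frac{n_3+n_4+n_5}{2}$, $Q_1=\frac{n_1+n_2+n_4+n_5}{2}$, $Q_2=\frac{n_1+n_3+n_4+n_6}{2}$, $Q_3=\frac{n_2+n_3+n_5+n_6}{2}$. *)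

theory Defs
  imports "HOL-Analysis.Analysis"
begin

section \<open>The regular ideal octahedron\<close>

text \<open>
  Hyperbolic 3-space in the projective (Klein) model: the underlying set is the open unit ball,
  geodesics are Euclidean segments, and the volume form of the metric of curvature -1 in
  dimension n is (1 - |x|^2) powr (-(n + 1)/2) dx; here n = 3.
\<close>

definition hyperbolic_volume :: "(real \<times> real \<times> real) measure" where
  "hyperbolic_volume =
     density lborel (\<lambda>x. ennreal (indicator (ball 0 1) x / (1 - (norm x)\<^sup>2)\<^sup>2))"

text \<open>
  The ideal points of the Klein model are the points of the unit sphere, and hyperbolic convex
  hulls are Euclidean ones.  The regular ideal octahedron is the one whose six ideal vertices are
  the plus and minus unit coordinate vectors.  The vertices themselves do not lie in hyperbolic
  space; they are removed by the intersection with the ball.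
\<close>

definition regular_ideal_octahedron :: "(real \<times> real \<times> real) set" where
  "regular_ideal_octahedron = convex hull (Basis \<union> uminus ` Basis) \<inter> ball 0 1"

definition v8 :: real where
  "v8 = measure hyperbolic_volume regular_ideal_octahedron"


section \<open>Quantum 6j-symbols at the root of unity exp (2 pi i / r)\<close>

definition root_q :: "nat \<Rightarrow> complex" where
  "root_q r = exp (2 * of_real pi * \<i> / of_nat r)"

definition qint :: "nat \<Rightarrow> int \<Rightarrow> complex" where
  "qint r n = root_q r powi n - root_q r powi (- n)"

definition qfact :: "nat \<Rightarrow> nat \<Rightarrow> complex" where
  "qfact r n = (\<Prod>i = 1..n. qint r (int i))"

definition zeta_r :: "nat \<Rightarrow> real" where
  "zeta_r r = 2 * sin (2 * pi / real r)"

text \<open>The bound 2r - 4 is written without truncated subtraction.\<close>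

definition admissible_triple :: "nat \<Rightarrow> nat \<Rightarrow> nat \<Rightarrow> nat \<Rightarrow> bool" where
  "admissible_triple r a b c \<longleftrightarrow>
     a + 2 \<le> r \<and> b + 2 \<le> r \<and> c + 2 \<le> r \<and>
     even (a + b + c) \<and> a + b + c + 4 \<le> 2 * r \<and>
     a \<le> b + c \<and> b \<le> a + c \<and> c \<le> a + b"

definition admissible ::
    "nat \<Rightarrow> nat \<Rightarrow> nat \<Rightarrow> nat \<Rightarrow> nat \<Rightarrow> nat \<Rightarrow> nat \<Rightarrow> bool" where
  "admissible r n1 n2 n3 n4 n5 n6 \<longleftrightarrow>
     admissible_triple r n1 n2 n3 \<and> admissible_triple r n1 n5 n6 \<and>
     admissible_triple r n2 n4 n6 \<and> admissible_triple r n3 n4 n5"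

text \<open>
  On admissible arguments all halves below are exact and no subtraction truncates.
  The argument of the square root is then real, and for real numbers \<^const>\<open>csqrt\<close> is the
  nonnegative root of a nonnegative number and the root with positive imaginary part of a
  negative one.
\<close>

definition Delta :: "nat \<Rightarrow> nat \<Rightarrow> nat \<Rightarrow> nat \<Rightarrow> complex" where
  "Delta r a b c =
     csqrt (\<i> * of_real (zeta_r r) *
       (qfact r ((a + b - c) div 2) * qfact r ((a + c - b) div 2) * qfact r ((b + c - a) div 2))
       / qfact r ((a + b + c) div 2 + 1))"

definition quantum_6j ::
    "nat \<Rightarrow> nat \<Rightarrow> nat \<Rightarrow> nat \<Rightarrow> nat \<Rightarrow> nat \<Rightarrow> nat \<Rightarrow> complex" where
  "quantum_6j r n1 n2 n3 n4 n5 n6 =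
    (let T1 = (n1 + n2 + n3) div 2; T2 = (n1 + n5 + n6) div 2;
         T3 = (n2 + n4 + n6) div 2; T4 = (n3 + n4 + n5) div 2;
         Q1 = (n1 + n2 + n4 + n5) div 2; Q2 = (n1 + n3 + n4 + n6) div 2;
         Q3 = (n2 + n3 + n5 + n6) div 2
     in inverse (of_real (zeta_r r)) * \<i> ^ (n1 + n2 + n3 + n4 + n5 + n6) *
        (Delta r n1 n2 n3 * Delta r n1 n5 n6 * Delta r n2 n4 n6 * Delta r n3 n4 n5) *
        (\<Sum>z = Max {T1, T2, T3, T4}..Min {Q1, Q2, Q3}.
           (- 1) ^ z * qfact r (z + 1) /
           ((qfact r (z - T1) * qfact r (z - T2) * qfact r (z - T3) * qfact r (z - T4)) *
            (qfact r (Q1 - z) * qfact r (Q2 - z) * qfact r (Q3 - z)))))"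

text \<open>Logarithm of a nonnegative real, with log 0 = -infinity (whereas \<^term>\<open>ln 0 = (0::real)\<close>).\<close>

definition elog :: "real \<Rightarrow> ereal" where
  "elog x = (if x = 0 then - \<infinity> else ereal (ln x))"

end

(*
  Let L be the Lobachevsky function.  Up to an error O(log r) the logarithm of |{n}!| is
  -(r / 2 pi) L(2 pi n / r).  For a summation index z put a_i = 2 pi (z - T_i) / r,
  b_j = 2 pi (Q_j - z) / r and b_4 = 2 pi - 2 pi z / r.  These eight numbers are nonnegative with
  sum exactly 2 pi, the numbers Q_j - T_i are precisely the twelve half-differences entering the
  Delta's, and so the exponential growth rate of the corresponding term is
     F = sum_i L(a_i) + sum_j L(b_j) - 1/2 sum_ij L(a_i + b_j),
  with i, j = 1, ..., 4.  The complete bipartite graph K(4,4) is a union of four 4-cycles, and F is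
  the sum of four functions G of the cyclically ordered variables of these cycles.  By the
  concavity of the volume of an ideal tetrahedron in its dihedral angles, G <= H(s), where s is
  the sum of the four variables and H is the value at four equal variables.  Complementary cycles
  have sums s and 2 pi - s, and H(s) + H(2 pi - s) <= 4 L(pi/4); hence F <= 8 L(pi/4).  Sums of two
  neighbours larger than pi need a separate, cruder estimate.  Finally, v8 = 8 L(pi/4) is found by
  integrating the hyperbolic volume density over the octahedron.
*)
theory Submission
  imports Defs
begin

section \<open>The Lobachevsky function\<close>

text \<open>Eight equal variables pi / 4 give F = 8 L(pi/4), each cycle contributing 2 L(pi/4). Yet
  one cycle alone does not obey the bound 2 L(pi/4): H has positive slope at s = pi. This is why
  complementary cycles are paired: in H(s) + H(2 pi - s) the terms L(s/2) cancel and a two-point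
  inequality remains. A 4-cycle is suited to tetrahedra because 2 G is the sum of two volumes, one
  for each of two opposite edges, minus L at the other two neighbour sums, and averaging the two
  tetrahedra leaves those sums unchanged. The volume is concave only where the two angles have sum
  at most pi; beyond that the bound acquires the extra term L(pi/2 - s/2), where s is now the sum of
  the variables minus pi, and the complementary cycle has enough slack to absorb it. The number b_4
  is 2 pi (r - z) / r, so that r acts as a fourth Q: this gives {z+1}! and the denominators of the
  Delta's the same form as all other factors. The passage from factorials to L uses that the
  logarithm of the sine is concave: midpoint sums bound its integral from above and trapezoid sums
  bound it from below.\<close>

definition lob :: "real \<Rightarrow> real" where
  "lob x = (\<Sum>n. sin (2 * real (Suc n) * x) / (2 * (real (Suc n))\<^sup>2))"

lemma summable_lob_bound: "summable (\<lambda>n. 1 / (2 * (real (Suc n))\<^sup>2))"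
proof -
  have "summable (\<lambda>n. inverse ((real (Suc n))\<^sup>2))"
    using inverse_power_summable[of 2, where ?'a = real] by (subst summable_Suc_iff) auto
  from summable_mult[OF this, of "1/2"] show ?thesis by (simp add: field_simps)
qed

lemma lob_term_bound: "\<bar>sin (2 * real (Suc n) * x) / (2 * (real (Suc n))\<^sup>2)\<bar> \<le> 1 / (2 * (real (Suc n))\<^sup>2)"
  by (simp add: abs_divide divide_right_mono del: of_nat_Suc)

lemma continuous_on_suminf_bounded:
  fixes f :: "nat \<Rightarrow> 'a :: topological_space \<Rightarrow> 'b :: banach"
  assumes "\<And>n. continuous_on A (f n)" "\<And>n x. x \<in> A \<Longrightarrow> norm (f n x) \<le> M n" "summable M"
  shows "continuous_on A (\<lambda>x. \<Sum>n. f n x)"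
  by (rule uniform_limit_theorem[OF _ Weierstrass_m_test[OF assms(2,3)]])
     (auto intro!: always_eventually continuous_on_sum assms(1))

lemma continuous_on_lob [continuous_intros]:
  assumes "continuous_on A f"
  shows "continuous_on A (\<lambda>x. lob (f x))"
proof -
  have "continuous_on UNIV lob"
    unfolding lob_def
    by (rule continuous_on_suminf_bounded[OF _ _ summable_lob_bound])
       (use lob_term_bound in \<open>auto intro!: continuous_intros simp del: of_nat_Suc\<close>)
  from continuous_on_compose2[OF this assms] show ?thesis by auto
qed

lemma lob_minus [simp]: "lob (- x) = - lob x"
proof -
  have "summable (\<lambda>n. sin (2 * real (Suc n) * x) / (2 * (real (Suc n))\<^sup>2))"
    by (rule summable_comparison_test[OF _ summable_lob_bound])
       (use lob_term_bound in \<open>auto simp del: of_nat_Suc\<close>)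
  from suminf_minus[OF this] show ?thesis by (simp add: lob_def)
qed

lemma lob_0 [simp]: "lob 0 = 0"
  using lob_minus[of 0] by simp

lemma lob_plus_pi [simp]: "lob (x + pi) = lob x"
proof -
  have "sin (2 * real (Suc n) * (x + pi)) = sin (2 * real (Suc n) * x)" for n
    using sin.plus_of_nat[of "2 * real (Suc n) * x" "Suc n"]
    by (simp add: algebra_simps)
  then show ?thesis by (simp add: lob_def)
qed

lemma lob_pi [simp]: "lob pi = 0"
  using lob_plus_pi[of 0] by simp

lemma lob_pi_minus [simp]: "lob (pi - x) = - lob x"
  using lob_plus_pi[of "- x"] by (simp add: algebra_simps)

lemma lob_minus_pi [simp]: "lob (x - pi) = lob x"
  using lob_plus_pi[of "x - pi"] by simp

lemma lob_2pi_minus [simp]: "lob (2 * pi - x) = - lob x"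
  using lob_plus_pi[of "pi - x"] by (simp add: algebra_simps)

lemma lob_pi_half [simp]: "lob (pi / 2) = 0"
  using lob_pi_minus[of "pi / 2"] by simp

section \<open>Derivative of the Lobachevsky function\<close>

lemma norm_one_minus_cis: "cmod (1 - cis (2 * x)) = 2 * \<bar>sin x\<bar>"
proof -
  have "(cmod (1 - cis (2 * x)))\<^sup>2 = (2 * \<bar>sin x\<bar>)\<^sup>2"
    unfolding cmod_power2 cis.sel minus_complex.sel one_complex.sel
    using sin_cos_squared_add[of "2 * x"] cos_double_sin[of x]
    by (simp add: power_mult_distrib power2_diff)
  then show ?thesis by (rule power2_eq_imp_eq) auto
qed

text \<open>The series of \<open>lob\<close> yields parity, period and continuity at once, but its
  termwise derivative, the sum of cos (2 n x) / n, does not converge absolutely. Abel's factor makes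
  it uniformly convergent, and its sum is the real part of the logarithm series.\<close>

lemma DERIV_lob_abel:
  fixes \<rho> x :: real
  assumes "0 < \<rho>" "\<rho> < 1"
  shows "((\<lambda>x. \<Sum>n. \<rho> ^ Suc n * (sin (2 * real (Suc n) * x) / (2 * (real (Suc n))\<^sup>2)))
           has_real_derivative - ln (cmod (1 - \<rho> * cis (2 * x)))) (at x)"
proof -
  let ?f = "\<lambda>n x. \<rho> ^ Suc n * (sin (2 * real (Suc n) * x) / (2 * (real (Suc n))\<^sup>2))"
  let ?g = "\<lambda>n x. \<rho> ^ Suc n * cos (2 * real (Suc n) * x) / real (Suc n)"
  have "((\<lambda>x. \<Sum>n. ?f n x) has_field_derivative (\<Sum>n. ?g n x)) (at x)"
  proof (rule has_field_derivative_series'(2)[of UNIV _ _ 0])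
    fix n and x :: real
    show "(?f n has_field_derivative ?g n x) (at x within UNIV)"
      by (auto intro!: derivative_eq_intros simp: power2_eq_square field_simps simp del: of_nat_Suc)
  next
    show "uniformly_convergent_on UNIV (\<lambda>n x. \<Sum>i<n. ?g i x)"
    proof (rule Weierstrass_m_test')
      fix n and x :: real
      have "\<bar>cos (2 * real (Suc n) * x) / real (Suc n)\<bar> \<le> 1"
        using frac_le[of 1 "\<bar>cos (2 * real (Suc n) * x)\<bar>" 1 "real (Suc n)"]
        by (simp del: of_nat_Suc)
      then have "\<rho> ^ Suc n * \<bar>cos (2 * real (Suc n) * x) / real (Suc n)\<bar> \<le> \<rho> ^ Suc n * 1"
        using assms by (intro mult_left_mono) auto
      then show "norm (?g n x) \<le> \<rho> ^ Suc n"
        using assms by (simp add: abs_mult abs_divide)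
      show "summable (\<lambda>n. \<rho> ^ Suc n)"
        using assms by (subst summable_Suc_iff) (auto intro: summable_geometric)
    qed
  qed auto
  moreover have "(\<lambda>n. ?g n x) sums - ln (cmod (1 - \<rho> * cis (2 * x)))"
  proof -
    let ?z = "complex_of_real \<rho> * cis (2 * x)"
    have n: "cmod (- ?z) < 1" using assms by (simp add: norm_mult)
    then have nz: "1 - ?z \<noteq> 0" by (metis eq_iff_diff_eq_0 norm_minus_cancel norm_one less_irrefl)
    from sums_minus[OF Ln_series'[OF n]] have "(\<lambda>n. ?z ^ n / of_nat n) sums - ln (1 - ?z)"
      by simp
    then have "(\<lambda>n. ?z ^ Suc n / of_nat (Suc n)) sums - ln (1 - ?z)"
      by (subst sums_Suc_iff) simp
    then have "(\<lambda>n. Re (?z ^ Suc n / of_nat (Suc n))) sums Re (- ln (1 - ?z))"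
      by (rule sums_Re)
    moreover have "Re (?z ^ Suc n / of_nat (Suc n)) = ?g n x" for n
    proof -
      have "?z ^ Suc n / of_nat (Suc n)
              = of_real (\<rho> ^ Suc n / real (Suc n)) * cis (real (Suc n) * (2 * x))"
        by (simp add: power_mult_distrib Complex.DeMoivre del: of_nat_Suc power_Suc)
      then show ?thesis by (simp add: mult_ac del: of_nat_Suc power_Suc)
    qed
    ultimately show ?thesis using nz by simp
  qed
  ultimately show ?thesis by (simp add: sums_iff)
qed

text \<open>The radius of the Abel means tends to 1. Their derivatives converge uniformly where the
  sine stays away from 0: there the argument of ln changes by at most 1 - \<open>r k\<close> and ln
  is Lipschitz with constant 2 / m.\<close>

lemma DERIV_lob_at:
  assumes "sin x \<noteq> 0"
  shows "(lob has_real_derivative - ln \<bar>2 * sin x\<bar>) (at x)"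
proof -
  define r where "r k = 1 - 1 / real (k + 2)" for k :: nat
  have r: "0 < r k" "r k < 1" for k by (auto simp: r_def field_simps)
  have r_lim: "r \<longlonglongrightarrow> 1"
  proof -
    have "(\<lambda>k. 1 - 1 / real (k + 2)) \<longlonglongrightarrow> 1 - 0"
      by (intro tendsto_intros LIMSEQ_ignore_initial_segment[OF lim_1_over_n, of 2])
    then show ?thesis by (simp add: r_def[abs_def])
  qed
  let ?f = "\<lambda>k x. \<Sum>n. r k ^ Suc n * (sin (2 * real (Suc n) * x) / (2 * (real (Suc n))\<^sup>2))"
  let ?B = "\<lambda>x. cmod (1 - cis (2 * x))"
  let ?A = "\<lambda>k x. cmod (1 - of_real (r k) * cis (2 * x))"
  define m where "m = \<bar>sin x\<bar>"
  have m: "m > 0" using assms by (simp add: m_def)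
  have "((\<lambda>t. \<bar>sin t\<bar>) \<longlongrightarrow> \<bar>sin x\<bar>) (at x)" by (intro tendsto_intros)
  from order_tendstoD(1)[OF this, of "m / 2"] m
  have "eventually (\<lambda>t. \<bar>sin t\<bar> > m / 2) (nhds x)"
    by (auto simp: eventually_nhds_conv_at m_def)
  then obtain d where d: "d > 0" "\<And>t. dist t x < d \<Longrightarrow> \<bar>sin t\<bar> > m / 2"
    by (auto simp: eventually_nhds_metric)
  let ?S = "ball x d"
  have B: "?B t > m" if "t \<in> ?S" for t
    using d(2)[of t] that by (simp add: norm_one_minus_cis dist_commute)
  have AB: "\<bar>?A k t - ?B t\<bar> \<le> 1 - r k" for k t
  proof -
    have "\<bar>?A k t - ?B t\<bar> \<le> cmod ((1 - of_real (r k) * cis (2 * t)) - (1 - cis (2 * t)))"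
      by (rule norm_triangle_ineq3)
    also have "(1 - of_real (r k) * cis (2 * t)) - (1 - cis (2 * t))
                 = of_real (1 - r k) * cis (2 * t)"
      by (simp add: algebra_simps)
    also have "cmod \<dots> = 1 - r k" unfolding norm_mult norm_of_real norm_cis using r(2)[of k] by simp
    finally show ?thesis .
  qed
  have lim: "(\<lambda>k. ?f k t) \<longlonglongrightarrow> lob t" for t
  proof -
    have c: "continuous_on {0..1} (\<lambda>\<rho>. \<Sum>n. \<rho> ^ Suc n * (sin (2 * real (Suc n) * t) / (2 * (real (Suc n))\<^sup>2)))"
    proof (rule continuous_on_suminf_bounded[OF _ _ summable_lob_bound])
      fix n and \<rho> :: real assume "\<rho> \<in> {0..1}"
      then have "\<bar>\<rho> ^ Suc n\<bar> * \<bar>sin (2 * real (Suc n) * t) / (2 * (real (Suc n))\<^sup>2)\<bar>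
           \<le> 1 * (1 / (2 * (real (Suc n))\<^sup>2))"
        by (intro mult_mono lob_term_bound) (auto intro: power_le_one simp del: power_Suc)
      then show "norm (\<rho> ^ Suc n * (sin (2 * real (Suc n) * t) / (2 * (real (Suc n))\<^sup>2)))
           \<le> 1 / (2 * (real (Suc n))\<^sup>2)"
        by (simp add: abs_mult del: of_nat_Suc power_Suc)
    qed (intro continuous_intros)
    have "\<forall>\<^sub>F k in sequentially. r k \<in> {0..1}"
      using r by (intro always_eventually) (auto intro: less_imp_le)
    from continuous_on_tendsto_compose[OF c r_lim _ this]
    have "(\<lambda>k. ?f k t) \<longlonglongrightarrow> (\<Sum>n. 1 ^ Suc n * (sin (2 * real (Suc n) * t) / (2 * (real (Suc n))\<^sup>2)))"
      by (simp del: of_nat_Suc power_Suc)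
    then show ?thesis by (simp add: lob_def)
  qed
  have "\<exists>g. \<forall>t\<in>?S. (\<lambda>k. ?f k t) \<longlonglongrightarrow> g t \<and> (g has_derivative (*) (- ln (?B t))) (at t within ?S)"
  proof (rule has_derivative_sequence)
    show "convex ?S" by simp
    show "(?f k has_derivative (*) (- ln (?A k t))) (at t within ?S)" for k t
      by (rule has_derivative_at_withinI)
         (rule DERIV_lob_abel[OF r, unfolded has_field_derivative_def])
    show "\<forall>\<^sub>F k in sequentially. \<forall>t\<in>?S. \<forall>h. norm (- ln (?A k t) * h - - ln (?B t) * h) \<le> e * norm h"
      if e: "e > 0" for e
    proof -
      have lim: "(\<lambda>k. 1 - r k) \<longlonglongrightarrow> 0"
        using tendsto_diff[OF tendsto_const[of 1] r_lim] by simp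
      have "\<forall>\<^sub>F k in sequentially. 1 - r k < min (m / 2) (e * m / 2)"
        by (rule order_tendstoD(2)[OF lim]) (use m e in auto)
      then show ?thesis
      proof eventually_elim
        case (elim k)
        show ?case
        proof (intro ballI allI)
          fix t h assume t: "t \<in> ?S"
          have A: "?A k t > m / 2" using AB[of k t] B[OF t] elim by linarith
          have "\<bar>ln (?A k t) - ln (?B t)\<bar> \<le> \<bar>?A k t - ?B t\<bar> / (m / 2)"
          proof -
            have "ln a - ln b \<le> \<bar>a - b\<bar> / (m / 2)" if "a > m / 2" "b > m / 2" for a b
            proof -
              have "ln a - ln b \<le> (a - b) / b" using that m ln_diff_le[of a b] by simp
              also have "\<dots> \<le> \<bar>a - b\<bar> / b" using that m by (intro divide_right_mono) auto
              also have "\<dots> \<le> \<bar>a - b\<bar> / (m / 2)" using that m by (intro divide_left_mono) auto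
              finally show ?thesis .
            qed
            from this[of "?A k t" "?B t"] this[of "?B t" "?A k t"] show ?thesis
              using A B[OF t] m by (simp add: abs_minus_commute abs_le_iff)
          qed
          also have "\<dots> \<le> e"
          proof -
            have "\<bar>?A k t - ?B t\<bar> \<le> e * m / 2" using AB[of k t] elim by linarith
            with m show ?thesis by (simp add: pos_divide_le_eq)
          qed
          finally have "\<bar>ln (?A k t) - ln (?B t)\<bar> * \<bar>h\<bar> \<le> e * \<bar>h\<bar>"
            by (rule mult_right_mono) simp
          moreover have "- ln (?A k t) * h - - ln (?B t) * h = - ((ln (?A k t) - ln (?B t)) * h)"
            by algebra
          ultimately show "norm (- ln (?A k t) * h - - ln (?B t) * h) \<le> e * norm h"
            by (simp only: real_norm_def abs_minus_cancel abs_mult)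
        qed
      qed
    qed
    show "x \<in> ?S" using d by simp
    show "(\<lambda>k. ?f k x) \<longlonglongrightarrow> lob x" by (rule lim)
  qed
  then obtain g where g: "\<And>t. t \<in> ?S \<Longrightarrow> (\<lambda>k. ?f k t) \<longlonglongrightarrow> g t"
    "\<And>t. t \<in> ?S \<Longrightarrow> (g has_derivative (*) (- ln (?B t))) (at t within ?S)" by blast
  \<comment> \<open>\<open>has_derivative_sequence\<close> provides only some limit function;
    uniqueness of limits identifies it with \<open>lob\<close>.\<close>
  have eq: "lob t = g t" if "t \<in> ?S" for t
    using LIMSEQ_unique[OF lim g(1)[OF that]] .
  have xS: "x \<in> ?S" using d by simp
  have "(g has_real_derivative - ln (?B x)) (at x)"
    using g(2)[OF xS] at_within_open[OF xS] by (simp add: has_field_derivative_def)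
  then have "(lob has_real_derivative - ln (?B x)) (at x)"
    by (rule has_field_derivative_transform_within_open[of _ _ _ ?S]) (use xS eq in auto)
  then show ?thesis by (simp add: norm_one_minus_cis abs_mult)
qed

lemma DERIV_lob [derivative_intros]:
  assumes "(f has_real_derivative f') (at x within A)" "sin (f x) \<noteq> 0"
  shows "((\<lambda>x. lob (f x)) has_real_derivative - ln \<bar>2 * sin (f x)\<bar> * f') (at x within A)"
  using DERIV_chain2[OF DERIV_lob_at[OF assms(2)] assms(1)] .

text \<open>The derivative of \<open>lob\<close> has logarithmic singularities at the multiples of
  pi. Continuity together with the sign of the derivative off a finite set is the form in which
  monotonicity can pass through them.\<close>

lemma mono_except_finite:
  fixes f g :: "real \<Rightarrow> real"
  assumes "a \<le> b" "finite S" "continuous_on {a..b} f"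
    and "\<And>x. a < x \<Longrightarrow> x < b \<Longrightarrow> x \<notin> S \<Longrightarrow> (f has_real_derivative g x) (at x)"
    and "\<And>x. a < x \<Longrightarrow> x < b \<Longrightarrow> x \<notin> S \<Longrightarrow> 0 \<le> g x"
  shows "f a \<le> f b"
proof -
  let ?g = "\<lambda>x. if x \<in> S \<union> {a, b} then 0 else g x"
  have "(?g has_integral (f b - f a)) {a..b}"
    by (rule fundamental_theorem_of_calculus_interior_strong[OF assms(2,1) _ assms(3)])
       (auto intro!: assms(4) simp: has_real_derivative_iff_has_vector_derivative[symmetric])
  moreover have "0 \<le> ?g x" if "x \<in> {a..b}" for x
    using that assms(5) by force
  ultimately show ?thesis by (fastforce dest: has_integral_nonneg)
qed

section \<open>Duplication formula and two-point inequalities\<close>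

lemma lob_double:
  assumes "0 \<le> x" "x \<le> pi"
  shows "lob (2 * x) = 2 * lob x - 2 * lob (pi / 2 - x)"
proof -
  define f where "f t = lob (2 * t) - 2 * lob t + 2 * lob (pi / 2 - t)" for t
  have D: "(f has_real_derivative 0) (at t)" if "0 < t" "t < x" "t \<notin> {pi / 2}" for t
  proof -
    have t: "sin t \<noteq> 0" using that assms sin_gt_zero[of t] by auto
    have c: "cos t \<noteq> 0"
    proof
      assume "cos t = 0"
      then have "t = pi / 2"
        using cos_inj_pi[of t "pi / 2"] that assms by auto
      with that show False by simp
    qed
    have "ln \<bar>2 * sin (2 * t)\<bar> = ln (\<bar>2 * sin t\<bar> * \<bar>2 * cos t\<bar>)"
      by (simp add: sin_double abs_mult)
    also have "\<dots> = ln \<bar>2 * sin t\<bar> + ln \<bar>2 * cos t\<bar>"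
      using t c by (subst ln_mult) auto
    finally have e: "ln \<bar>2 * sin (2 * t)\<bar> = ln \<bar>2 * sin t\<bar> + ln \<bar>2 * cos t\<bar>" .
    have s: "sin (pi / 2 - t) = cos t" by (simp add: sin_diff)
    have s2: "sin (2 * t) \<noteq> 0" using t c by (simp add: sin_double)
    show ?thesis
      unfolding f_def using t c s2 e
      by (auto intro!: derivative_eq_intros simp: s)
  qed
  have cont: "continuous_on {0..x} f"
    unfolding f_def by (intro continuous_intros)
  \<comment> \<open>Constancy of \<open>f\<close> across the singularity at pi / 2 comes from
    monotonicity applied to \<open>f\<close> and to its negative.\<close>
  have "f 0 \<le> f x"
    by (rule mono_except_finite[where S = "{pi / 2}", OF _ _ cont D]) (use assms in auto)
  moreover have "- f 0 \<le> - f x"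
    by (rule mono_except_finite[where f = "\<lambda>t. - f t" and S = "{pi / 2}" and g = "\<lambda>_. 0"])
       (use assms cont D in \<open>auto intro!: continuous_intros derivative_eq_intros\<close>)
  ultimately show ?thesis by (simp add: f_def)
qed

text \<open>The derivative in t of lob (m + t) + lob (m - t) is nonpositive because |sin (m - t)| is
  at most sin (m + t), both products in the addition formula being nonnegative. This serves in place
  of concavity: t may exceed m, so that m - t becomes negative.\<close>

lemma lob_spread:
  assumes "0 \<le> d" "d \<le> d'" "d' \<le> pi / 2" "0 \<le> m" "m \<le> pi / 2"
  shows "lob (m + d') + lob (m - d') \<le> lob (m + d) + lob (m - d)"
proof -
  define f where "f t = - (lob (m + t) + lob (m - t))" for t
  have "f d \<le> f d'"
  proof (rule mono_except_finite[where f = f and S = "{m}" and g = "\<lambda>t. ln \<bar>2 * sin (m + t)\<bar> - ln \<bar>2 * sin (m - t)\<bar>"])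
    show "continuous_on {d..d'} f" unfolding f_def by (intro continuous_intros)
    fix t assume "d < t" "t < d'" "t \<notin> {m}"
    then have t: "0 < t" "t < pi / 2" "t \<noteq> m" using assms by auto
    have p: "sin (m + t) > 0" using t assms by (intro sin_gt_zero) auto
    have n: "sin (m - t) \<noteq> 0"
    proof (cases "m < t")
      case True
      then have "sin (t - m) > 0" using t assms by (intro sin_gt_zero) auto
      then show ?thesis using sin_minus[of "t - m"] by auto
    next
      case False
      then have "sin (m - t) > 0" using t assms by (intro sin_gt_zero) auto
      then show ?thesis by auto
    qed
    show "(f has_real_derivative ln \<bar>2 * sin (m + t)\<bar> - ln \<bar>2 * sin (m - t)\<bar>) (at t)"
      unfolding f_def using p n by (auto intro!: derivative_eq_intros)
    have "0 \<le> sin m" "0 \<le> cos m" "0 \<le> sin t" "0 \<le> cos t"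
      using t assms by (auto intro: sin_ge_zero cos_ge_zero)
    then have "0 \<le> sin m * cos t" "0 \<le> cos m * sin t" by auto
    then have "\<bar>2 * sin (m - t)\<bar> \<le> \<bar>2 * sin (m + t)\<bar>"
      by (auto simp: sin_add sin_diff abs_le_iff abs_if)
    then show "0 \<le> ln \<bar>2 * sin (m + t)\<bar> - ln \<bar>2 * sin (m - t)\<bar>"
      using p n by simp
  qed (use assms in auto)
  then show ?thesis by (simp add: f_def)
qed

lemma lob_add_le_mid:
  assumes "0 \<le> x + y" "x + y \<le> pi" "\<bar>x - y\<bar> \<le> pi"
  shows "lob x + lob y \<le> 2 * lob ((x + y) / 2)"
proof -
  have "lob ((x + y) / 2 + \<bar>x - y\<bar> / 2) + lob ((x + y) / 2 - \<bar>x - y\<bar> / 2)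
        \<le> lob ((x + y) / 2 + 0) + lob ((x + y) / 2 - 0)"
    using assms by (intro lob_spread) auto
  moreover have "lob ((x + y) / 2 + \<bar>x - y\<bar> / 2) + lob ((x + y) / 2 - \<bar>x - y\<bar> / 2) = lob x + lob y"
    by (cases "x \<ge> y") (simp_all add: abs_if field_simps)
  ultimately show ?thesis by simp
qed

text \<open>Among the pairs of nonnegative numbers with a given sum, the pair of that sum and 0 is
  the widest.\<close>

lemma lob_subadditive:
  assumes "0 \<le> x" "0 \<le> y" "x + y \<le> pi"
  shows "lob (x + y) \<le> lob x + lob y"
proof -
  have "lob ((x + y) / 2 + (x + y) / 2) + lob ((x + y) / 2 - (x + y) / 2)
        \<le> lob ((x + y) / 2 + \<bar>x - y\<bar> / 2) + lob ((x + y) / 2 - \<bar>x - y\<bar> / 2)"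
    using assms by (intro lob_spread) auto
  moreover have "lob ((x + y) / 2 + \<bar>x - y\<bar> / 2) + lob ((x + y) / 2 - \<bar>x - y\<bar> / 2) = lob x + lob y"
    by (cases "x \<ge> y") (simp_all add: abs_if field_simps)
  ultimately show ?thesis by simp
qed

text \<open>The two-point inequality for 2 x - pi / 2 and pi / 2, the latter being a zero of
  \<open>lob\<close>.\<close>

lemma lob_double_le:
  assumes "0 \<le> x" "x \<le> pi / 2"
  shows "lob (2 * x - pi / 2) \<le> 2 * lob x"
  using lob_add_le_mid[of "2 * x - pi / 2" "pi / 2"] assms by simp

text \<open>\<open>lob\<close> vanishes at 0 and pi / 2, rises up to pi / 6, where 2 sin x = 1, and
  falls from there on.\<close>

lemma lob_nonneg:
  assumes "0 \<le> x" "x \<le> pi / 2"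
  shows "0 \<le> lob x"
proof (cases "x \<le> pi / 6")
  case True
  have "lob 0 \<le> lob x"
  proof (rule mono_except_finite[where f = lob and S = "{}" and g = "\<lambda>t. - ln \<bar>2 * sin t\<bar>"])
    fix t assume "0 < t" "t < x"
    then have t: "0 < t" "t \<le> pi / 6" using True by auto
    then have p: "sin t > 0" by (intro sin_gt_zero) auto
    show "(lob has_real_derivative - ln \<bar>2 * sin t\<bar>) (at t)" using p by (intro DERIV_lob_at) auto
    have "sin t \<le> sin (pi / 6)" using t by (intro sin_monotone_2pi_le) auto
    then show "0 \<le> - ln \<bar>2 * sin t\<bar>" using p by (simp add: sin_30)
  qed (use assms in \<open>auto intro: continuous_intros\<close>)
  then show ?thesis by simp
next
  case False
  have "- lob x \<le> - lob (pi / 2)"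
  proof (rule mono_except_finite[where f = "\<lambda>t. - lob t" and S = "{}" and g = "\<lambda>t. ln \<bar>2 * sin t\<bar>"])
    fix t assume "x < t" "t < pi / 2"
    then have t: "pi / 6 \<le> t" "t \<le> pi / 2" "0 < t" using False assms by auto
    then have p: "sin t > 0" by (intro sin_gt_zero) auto
    show "((\<lambda>t. - lob t) has_real_derivative ln \<bar>2 * sin t\<bar>) (at t)"
      using p by (auto intro!: derivative_eq_intros)
    have "sin (pi / 6) \<le> sin t" using t by (intro sin_monotone_2pi_le) auto
    then show "0 \<le> ln \<bar>2 * sin t\<bar>" using p by (simp add: sin_30)
  qed (use assms in \<open>auto intro!: continuous_intros\<close>)
  then show ?thesis by simp
qed

section \<open>Ideal tetrahedra and the bipartite inequality\<close>

text \<open>This is the sign of the second derivative of \<open>tetra\<close> in the direction (v,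
  w). Multiplied by cot x + cot y > 0, the difference of the two sides becomes a sum of two squares
  by the addition formula of the cotangent.\<close>

lemma cot_add_quadratic_le:
  fixes x y v w :: real
  assumes "0 < x" "0 < y" "x + y < pi"
  shows "(v + w)\<^sup>2 * cot (x + y) \<le> v\<^sup>2 * cot x + w\<^sup>2 * cot y"
proof -
  define t s where "t = cot x" "s = cot y"
  have p: "sin x > 0" "sin y > 0" "sin (x + y) > 0"
    using assms by (auto intro!: sin_gt_zero)
  have ts: "t + s = sin (x + y) / (sin x * sin y)"
    using p by (simp add: t_s_def cot_def sin_add field_simps)
  then have pos: "t + s > 0" using p by simp
  have "cot (x + y) * (t + s) = t * s - 1"
    unfolding ts using p by (simp add: t_s_def cot_def cos_add field_simps)
  then have "(v\<^sup>2 * t + w\<^sup>2 * s - (v + w)\<^sup>2 * cot (x + y)) * (t + s)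
      = (v * t - w * s)\<^sup>2 + (v + w)\<^sup>2"
    by algebra
  then have "0 \<le> (v\<^sup>2 * t + w\<^sup>2 * s - (v + w)\<^sup>2 * cot (x + y)) * (t + s)"
    by simp
  then have "0 \<le> v\<^sup>2 * t + w\<^sup>2 * s - (v + w)\<^sup>2 * cot (x + y)"
    using pos by (simp add: zero_le_mult_iff)
  then show ?thesis by (simp add: t_s_def)
qed

text \<open>The volume of the ideal tetrahedron with dihedral angles \<open>x\<close>, \<open>y\<close>, \<open>\<pi> - x - y\<close>.\<close>
definition tetra :: "real \<Rightarrow> real \<Rightarrow> real" where
  "tetra x y = lob x + lob y - lob (x + y)"

lemma DERIV_ln_2sin:
  assumes "(f has_real_derivative f') (at x)" "sin (f x) > 0"
  shows "((\<lambda>x. ln \<bar>2 * sin (f x)\<bar>) has_real_derivative cot (f x) * f') (at x)"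
proof -
  have "((\<lambda>x. ln (2 * sin (f x))) has_real_derivative cot (f x) * f') (at x)"
    using assms by (auto intro!: derivative_eq_intros simp: cot_def field_simps)
  moreover have "eventually (\<lambda>t. sin (f t) > 0) (nhds x)"
  proof -
    have "isCont (\<lambda>t. sin (f t)) x"
      using assms(1) by (intro continuous_intros DERIV_isCont)
    then have "((\<lambda>t. sin (f t)) \<longlongrightarrow> sin (f x)) (at x)" by (simp add: isCont_def)
    from order_tendstoD(1)[OF this, of 0] assms(2) show ?thesis
      by (simp add: eventually_nhds_conv_at)
  qed
  then have "eventually (\<lambda>t. ln (2 * sin (f t)) = ln \<bar>2 * sin (f t)\<bar>) (nhds x)"
    by eventually_elim simp
  ultimately show ?thesis
    using DERIV_cong_ev[of x x] by auto
qed

lemma tetra_midpoint_concave: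
  assumes nn: "0 \<le> x1" "0 \<le> y1" "0 \<le> x2" "0 \<le> y2"
    and le: "x1 + y1 \<le> pi" "x2 + y2 \<le> pi"
  shows "tetra x1 y1 + tetra x2 y2 \<le> 2 * tetra ((x1 + x2) / 2) ((y1 + y2) / 2)"
proof -
  define mx my v w where "mx = (x1 + x2) / 2" "my = (y1 + y2) / 2" "v = (x1 - x2) / 2" "w = (y1 - y2) / 2"
  note defs = this
  have x: "x1 = mx + v" "x2 = mx - v" and y: "y1 = my + w" "y2 = my - w"
    by (simp_all add: defs field_simps)
  \<comment> \<open>A midpoint on an edge of the triangle forces both points onto that edge, where
    \<open>tetra\<close> is 0. Otherwise the open segment between the two points lies in the open
    triangle.\<close>
  consider "mx = 0" | "my = 0" | "mx + my = pi" | "mx \<noteq> 0" "my \<noteq> 0" "mx + my \<noteq> pi" by blast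
  then show ?thesis
  proof cases
    case 1
    then have "x1 = 0" "x2 = 0" using nn by (auto simp: defs)
    then show ?thesis by (simp add: tetra_def)
  next
    case 2
    then have "y1 = 0" "y2 = 0" using nn by (auto simp: defs)
    then show ?thesis by (simp add: tetra_def)
  next
    case 3
    have "x1 + y1 = pi" "x2 + y2 = pi" using le 3 by (simp_all add: defs field_simps)
    then have "y1 = pi - x1" "y2 = pi - x2" "(y1 + y2) / 2 = pi - (x1 + x2) / 2"
      by (simp_all add: field_simps)
    then show ?thesis by (simp only: tetra_def lob_pi_minus) simp
  next
    case 4
    have between: "\<bar>t * u\<bar> < m" if "\<bar>t\<bar> < 1" "\<bar>u\<bar> \<le> m" "m \<noteq> 0" for t u m :: real
    proof -
      have "\<bar>t\<bar> * \<bar>u\<bar> \<le> \<bar>t\<bar> * m" using that by (intro mult_left_mono) auto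
      also have "\<dots> < 1 * m" using that by (intro mult_strict_right_mono) auto
      finally show ?thesis by (simp add: abs_mult)
    qed
    have inside: "0 < mx + t * v" "0 < my + t * w" "(mx + t * v) + (my + t * w) < pi" if "\<bar>t\<bar> < 1" for t
    proof -
      have "\<bar>t * v\<bar> < mx" "\<bar>t * w\<bar> < my" "\<bar>t * (v + w)\<bar> < pi - (mx + my)"
        using that 4 nn le x y by (auto intro!: between simp del: abs_mult)
      then show "0 < mx + t * v" "0 < my + t * w" "(mx + t * v) + (my + t * w) < pi"
        by (auto simp: algebra_simps)
    qed
    define p where "p t = - ln \<bar>2 * sin (mx + t * v)\<bar> * v - ln \<bar>2 * sin (my + t * w)\<bar> * w
        + ln \<bar>2 * sin ((mx + t * v) + (my + t * w))\<bar> * (v + w)" for t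
    have sin_pos: "sin (mx + t * v) > 0" "sin (my + t * w) > 0" "sin ((mx + t * v) + (my + t * w)) > 0"
      if "\<bar>t\<bar> < 1" for t
      using inside[OF that] by (auto intro!: sin_gt_zero)
    have p_antimono: "p b \<le> p a" if "a \<le> b" "-1 < a" "b < 1" for a b
    proof (rule DERIV_nonpos_imp_nonincreasing[OF \<open>a \<le> b\<close>])
      fix t assume "a \<le> t" "t \<le> b"
      then have t: "\<bar>t\<bar> < 1" using that by auto
      let ?d = "- (cot (mx + t * v) * v) * v - (cot (my + t * w) * w) * w
              + (cot ((mx + t * v) + (my + t * w)) * (v + w)) * (v + w)"
      have "(p has_real_derivative ?d) (at t)"
        unfolding p_def
        by (intro DERIV_add DERIV_diff DERIV_minus DERIV_cmult_right DERIV_ln_2sin sin_pos[OF t])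
           (auto intro!: derivative_eq_intros simp: algebra_simps)
      moreover have "?d \<le> 0"
        using cot_add_quadratic_le[OF inside[OF t], of v w]
        by (simp add: power2_eq_square algebra_simps)
      ultimately show "\<exists>y. (p has_real_derivative y) (at t) \<and> y \<le> 0" by blast
    qed
    define P where "P t = tetra (mx + t * v) (my + t * w)" for t
    have P: "(P has_real_derivative p t) (at t)" if "\<bar>t\<bar> < 1" for t
      unfolding P_def p_def tetra_def using sin_pos[OF that]
      by (auto intro!: derivative_eq_intros simp: algebra_simps)
    \<comment> \<open>The ends of the segment may lie on the boundary, where differentiability can
      fail; continuity reaches them.\<close>
    have "P 0 + P (- 0) \<ge> P 1 + P (- 1)"
    proof (rule DERIV_nonpos_imp_decreasing_open[where f = "\<lambda>t. P t + P (- t)"])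
      fix t :: real assume t: "0 < t" "t < 1"
      have "((\<lambda>t. P t + P (- t)) has_real_derivative p t + p (- t) * (- 1)) (at t)"
        by (intro DERIV_add DERIV_chain2[of P] P DERIV_minus DERIV_ident) (use t in auto)
      moreover have "p t \<le> p (- t)" using t by (intro p_antimono) auto
      ultimately show "\<exists>y. ((\<lambda>t. P t + P (- t)) has_real_derivative y) (at t) \<and> y \<le> 0"
        by (intro exI[of _ "p t - p (- t)"]) simp
    next
      show "continuous_on {0..1} (\<lambda>t. P t + P (- t))"
        unfolding P_def tetra_def by (intro continuous_intros)
    qed simp
    then show ?thesis unfolding P_def x y by (simp add: field_simps)
  qed
qed

section \<open>Functions on 4-cycles and the pairing of complementary cycles\<close>

definition quad :: "real \<Rightarrow> real \<Rightarrow> real \<Rightarrow> real \<Rightarrow> real" where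
  "quad x1 x2 x3 x4 = (lob x1 + lob x2 + lob x3 + lob x4
     - lob (x1 + x2) - lob (x2 + x3) - lob (x3 + x4) - lob (x4 + x1)) / 2"

lemma quad_rotate: "quad x2 x3 x4 x1 = quad x1 x2 x3 x4"
  by (simp add: quad_def add_ac)

definition quad_bound :: "real \<Rightarrow> real" where
  "quad_bound s = 2 * lob (s / 4) - 2 * lob (s / 2)"

text \<open>The tetrahedra of the edges x1 x2 and x4 x3 are averaged with x4 matched to x1 and x3 to
  x2, so that the sums p and q along the two other edges survive unchanged.\<close>

lemma quad_le_pairs:
  assumes nn: "0 \<le> x1" "0 \<le> x2" "0 \<le> x3" "0 \<le> x4"
    and le: "x1 + x2 \<le> pi" "x3 + x4 \<le> pi"
  shows "quad x1 x2 x3 x4 \<le> quad_bound (x1 + x2 + x3 + x4)"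
proof -
  define p q s where "p = x2 + x3" "q = x4 + x1" "s = x1 + x2 + x3 + x4"
  note defs = this
  have s: "s = p + q" "0 \<le> p" "0 \<le> q" "s \<le> 2 * pi" using nn le by (auto simp: defs)
  have "2 * quad x1 x2 x3 x4 = tetra x1 x2 + tetra x4 x3 - lob p - lob q"
    by (simp add: quad_def tetra_def defs add_ac)
  also have "\<dots> \<le> 2 * tetra (q / 2) (p / 2) - lob p - lob q"
    using tetra_midpoint_concave[of x1 x2 x4 x3] nn le by (simp add: defs add_ac)
  \<comment> \<open>Duplication absorbs the terms of the other two edges: 2 lob (p / 2) - lob p is 2
    lob (pi / 2 - p / 2). The same formula at s / 4 undoes this at the end.\<close>
  also have "\<dots> = 2 * (lob (pi / 2 - p / 2) + lob (pi / 2 - q / 2)) - 2 * lob (s / 2)"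
    using lob_double[of "p / 2"] lob_double[of "q / 2"] s
    by (simp add: tetra_def add_divide_distrib add_ac)
  also have "\<dots> \<le> 4 * lob (pi / 2 - s / 4) - 2 * lob (s / 2)"
  proof -
    have e: "(pi / 2 - p / 2 + (pi / 2 - q / 2)) / 2 = pi / 2 - s / 4" using s by (simp add: field_simps)
    have "lob (pi / 2 - p / 2) + lob (pi / 2 - q / 2)
        \<le> 2 * lob ((pi / 2 - p / 2 + (pi / 2 - q / 2)) / 2)"
      using s by (intro lob_add_le_mid) (auto simp: abs_le_iff)
    then show ?thesis unfolding e by simp
  qed
  also have "\<dots> = 2 * quad_bound s"
  proof -
    have "0 \<le> s / 4" "s / 4 \<le> pi" using s by auto
    from lob_double[OF this] have "lob (s / 2) = 2 * lob (s / 4) - 2 * lob (pi / 2 - s / 4)" by simp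
    then show ?thesis by (simp add: quad_bound_def)
  qed
  finally show ?thesis by (simp add: defs)
qed

lemma quad_le:
  assumes "0 \<le> x1" "0 \<le> x2" "0 \<le> x3" "0 \<le> x4"
    and "x1 + x2 \<le> pi \<and> x3 + x4 \<le> pi \<or> x2 + x3 \<le> pi \<and> x4 + x1 \<le> pi"
  shows "quad x1 x2 x3 x4 \<le> quad_bound (x1 + x2 + x3 + x4)"
  using assms quad_le_pairs[of x1 x2 x3 x4] quad_le_pairs[of x2 x3 x4 x1] quad_rotate[of x2 x3 x4 x1]
  by (auto simp: add_ac)

text \<open>When both sums at the vertex \<open>x1\<close> exceed \<open>\<pi>\<close>, the argument \<open>x1\<close> is moved below \<open>0\<close>
  by periodicity and truncated.\<close>
lemma quad_le_large:
  assumes nn: "0 \<le> x1" "0 \<le> x2" "0 \<le> x3" "0 \<le> x4"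
    and ge: "pi \<le> x1 + x2" "pi \<le> x4 + x1" and s: "s = x1 + x2 + x3 + x4 - pi" "s \<le> pi"
  shows "quad x1 x2 x3 x4 \<le> quad_bound s + lob (pi / 2 - s / 2)"
proof (cases "x1 \<le> pi")
  case False
  have "quad x1 x2 x3 x4 = quad (x1 - pi) x2 x3 x4"
    using lob_minus_pi[of x1] lob_minus_pi[of "x1 + x2"] lob_minus_pi[of "x4 + x1"]
    by (simp add: quad_def algebra_simps)
  also have "\<dots> \<le> quad_bound s"
  proof -
    have e: "x1 - pi + x2 + x3 + x4 = s" using s by simp
    have "x1 - pi + x2 \<le> pi" "x3 + x4 \<le> pi" "0 \<le> x1 - pi" using False nn s by auto
    then show ?thesis using quad_le[of "x1 - pi" x2 x3 x4, unfolded e] nn by simp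
  qed
  also have "\<dots> \<le> quad_bound s + lob (pi / 2 - s / 2)"
    using lob_nonneg[of "pi / 2 - s / 2"] s nn ge by simp
  finally show ?thesis .
next
  case True
  define \<alpha> where "\<alpha> = pi - x1"
  have \<alpha>: "0 \<le> \<alpha>" "\<alpha> \<le> x2" "\<alpha> \<le> x4" using True ge by (auto simp: \<alpha>_def)
  have s': "s = (x2 + x3) + (x4 - \<alpha>)" by (simp add: s \<alpha>_def)
  have x1: "lob x1 = - lob \<alpha>"
    using lob_pi_minus[of \<alpha>] by (simp add: \<alpha>_def)
  have x12: "lob (x1 + x2) = lob (x2 - \<alpha>)" and x41: "lob (x4 + x1) = lob (x4 - \<alpha>)"
    using lob_plus_pi[of "x2 - \<alpha>"] lob_plus_pi[of "x4 - \<alpha>"] by (simp_all add: \<alpha>_def algebra_simps)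
  \<comment> \<open>Truncation replaces the pair (-\<alpha>, x2) by (0, x2 - \<alpha>); by
    subadditivity this can only increase the value.\<close>
  have le1: "lob x2 \<le> lob \<alpha> + lob (x2 - \<alpha>)"
    using lob_subadditive[of \<alpha> "x2 - \<alpha>"] \<alpha> nn s s' by simp
  \<comment> \<open>The truncated pair forms a degenerate tetrahedron of volume 0, so averaging with
    it costs nothing and brings the sum of the two angles down to s / 2.\<close>
  have le2: "tetra x4 x3 \<le> 2 * tetra (x4 / 2) ((x3 + x2 - \<alpha>) / 2)"
    using tetra_midpoint_concave[of x4 x3 0 "x2 - \<alpha>"] \<alpha> nn s s'
    by (simp add: tetra_def[of 0] add_diff_eq)
  have le3: "tetra (x4 / 2) ((x3 + x2 - \<alpha>) / 2) \<le> 2 * lob (s / 4) - lob (s / 2)"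
  proof -
    have e: "x4 / 2 + (x3 + x2 - \<alpha>) / 2 = s / 2" "s / 2 / 2 = s / 4" by (simp_all add: s' field_simps)
    have "lob (x4 / 2) + lob ((x3 + x2 - \<alpha>) / 2) \<le> 2 * lob (s / 4)"
    proof (rule lob_add_le_mid[of "x4 / 2" "(x3 + x2 - \<alpha>) / 2", unfolded e])
      show "0 \<le> s / 2" "s / 2 \<le> pi" using \<alpha> nn s' s(2) by auto
      show "\<bar>x4 / 2 - (x3 + x2 - \<alpha>) / 2\<bar> \<le> pi"
        using \<alpha> nn s' s(2) by (auto simp: abs_if field_simps)
    qed
    then show ?thesis unfolding tetra_def e by simp
  qed
  \<comment> \<open>The crude step: the two sums that are kept exactly in
    \<open>quad_le_pairs\<close> are merged into s. After duplication the price is the extra term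
    lob (pi / 2 - s / 2).\<close>
  have le4: "lob s \<le> lob (x2 + x3) + lob (x4 - \<alpha>)"
    unfolding s' using \<alpha> nn s(2) s' by (intro lob_subadditive) auto
  have d: "lob s = 2 * lob (s / 2) - 2 * lob (pi / 2 - s / 2)"
  proof -
    have "0 \<le> s / 2" "s / 2 \<le> pi" using \<alpha> nn s' s(2) by auto
    from lob_double[OF this] show ?thesis by simp
  qed
  have "2 * quad x1 x2 x3 x4
          = (lob x2 - lob \<alpha> - lob (x2 - \<alpha>)) + tetra x4 x3 - (lob (x2 + x3) + lob (x4 - \<alpha>))"
    by (simp add: quad_def tetra_def x1 x12 x41 add.commute[of x4 x3])
  also have "\<dots> \<le> 2 * (2 * lob (s / 4) - lob (s / 2)) - lob s"
  proof -
    have "tetra x4 x3 \<le> 2 * (2 * lob (s / 4) - lob (s / 2))" 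
      using order_trans[OF le2 mult_left_mono[OF le3, of 2]] by simp
    then show ?thesis using le1 le4 by linarith
  qed
  finally show ?thesis unfolding d by (simp add: quad_bound_def)
qed

lemma quad_bound_add_le: "quad_bound s + quad_bound (2 * pi - s) \<le> 4 * lob (pi / 4)"
  if "0 \<le> s" "s \<le> 2 * pi"
proof -
  have e: "lob ((2 * pi - s) / 2) = - lob (s / 2)"
    using lob_pi_minus[of "s / 2"] by (simp add: diff_divide_distrib)
  have "lob (s / 4) + lob ((2 * pi - s) / 4) \<le> 2 * lob (pi / 4)"
    using lob_add_le_mid[of "s / 4" "(2 * pi - s) / 4"] that by (simp add: field_simps abs_le_iff)
  then show ?thesis unfolding quad_bound_def e by simp
qed

text \<open>The pairs {pi / 4, 2 t} and {t, pi / 4 + t} have the same sum, and the first pair is the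
  closer one.\<close>

lemma quad_bound_le:
  assumes "0 \<le> t" "t \<le> pi / 4"
  shows "quad_bound (4 * t) \<le> 2 * lob (pi / 4) - 2 * lob (pi / 4 + t)"
proof -
  have "lob (pi / 8 + t + pi / 8) + lob (pi / 8 + t - pi / 8)
      \<le> lob (pi / 8 + t + \<bar>pi / 8 - t\<bar>) + lob (pi / 8 + t - \<bar>pi / 8 - t\<bar>)"
    using assms by (intro lob_spread) (auto simp: abs_if)
  moreover have "lob (pi / 8 + t + \<bar>pi / 8 - t\<bar>) + lob (pi / 8 + t - \<bar>pi / 8 - t\<bar>) = lob (pi / 4) + lob (2 * t)"
    by (cases "t \<le> pi / 8") (simp_all add: abs_if)
  moreover have "pi / 8 + t + pi / 8 = pi / 4 + t" "pi / 8 + t - pi / 8 = t" by simp_all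
  ultimately have "lob (pi / 4 + t) + lob t \<le> lob (pi / 4) + lob (2 * t)" by simp
  then show ?thesis by (simp add: quad_bound_def)
qed

text \<open>With s = 4 t, the extra term is at most 2 lob (pi / 2 - t), which is precisely what
  \<open>quad_bound_le\<close> at pi / 4 - t subtracts for the complementary cycle.\<close>

lemma quad_bound_large_le:
  assumes "0 \<le> s" "s \<le> pi"
  shows "quad_bound s + lob (pi / 2 - s / 2) + quad_bound (pi - s) \<le> 4 * lob (pi / 4)"
proof -
  define t where "t = s / 4"
  have t: "0 \<le> t" "t \<le> pi / 4" "s = 4 * t" using assms by (auto simp: t_def)
  have "quad_bound s \<le> 2 * lob (pi / 4) - 2 * lob (pi / 4 + t)"
    using quad_bound_le[of t] t by simp
  moreover have "quad_bound (pi - s) \<le> 2 * lob (pi / 4) - 2 * lob (pi / 2 - t)"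
    using quad_bound_le[of "pi / 4 - t"] t by (simp add: algebra_simps)
  moreover have "lob (pi / 2 - s / 2) \<le> 2 * lob (pi / 2 - t)"
    using lob_double_le[of "pi / 2 - t"] t by simp
  moreover have "0 \<le> lob (pi / 4 + t)"
    using t by (intro lob_nonneg) auto
  ultimately show ?thesis by simp
qed

lemma quad_add_le_large:
  assumes x: "0 \<le> x1" "0 \<le> x2" "0 \<le> x3" "0 \<le> x4"
    and y: "0 \<le> y1" "0 \<le> y2" "0 \<le> y3" "0 \<le> y4"
    and sum: "x1 + x2 + x3 + x4 + y1 + y2 + y3 + y4 = 2 * pi"
    and ge: "pi \<le> x1 + x2 + x3 + x4"
  shows "quad x1 x2 x3 x4 + quad y1 y2 y3 y4 \<le> 4 * lob (pi / 4)"
proof -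
  define s where "s = x1 + x2 + x3 + x4"
  have s: "y1 + y2 + y3 + y4 = 2 * pi - s" "pi \<le> s" "s \<le> 2 * pi" using sum y ge by (auto simp: s_def)
  \<comment> \<open>The y have sum at most pi, so no sum of two neighbours exceeds pi.\<close>
  have Y: "quad y1 y2 y3 y4 \<le> quad_bound (2 * pi - s)"
    using quad_le[of y1 y2 y3 y4] y s by simp
  show ?thesis
  proof (cases "x1 + x2 \<le> pi \<and> x3 + x4 \<le> pi \<or> x2 + x3 \<le> pi \<and> x4 + x1 \<le> pi")
    case True
    then show ?thesis
      using quad_le[OF x True] Y quad_bound_add_le[of s] s by (simp add: s_def)
  next
    case False
    \<comment> \<open>One edge from each pair of opposite edges has sum above pi. Two such edges
      meet in a vertex, and a rotation makes it the first one.\<close>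
    have X: "quad x1 x2 x3 x4 \<le> quad_bound (s - pi) + lob (pi / 2 - (s - pi) / 2)"
      using False quad_le_large[of x1 x2 x3 x4 "s - pi"] quad_le_large[of x2 x3 x4 x1 "s - pi"]
        quad_le_large[of x3 x4 x1 x2 "s - pi"] quad_le_large[of x4 x1 x2 x3 "s - pi"] x s
        quad_rotate[of x1 x2 x3 x4] quad_rotate[of x2 x3 x4 x1] quad_rotate[of x3 x4 x1 x2]
      by (auto simp: s_def not_le add_ac)
    show ?thesis
      using quad_bound_large_le[of "s - pi"] X Y s by (simp add: algebra_simps)
  qed
qed

lemma quad_add_le:
  assumes "0 \<le> x1" "0 \<le> x2" "0 \<le> x3" "0 \<le> x4" "0 \<le> y1" "0 \<le> y2" "0 \<le> y3" "0 \<le> y4"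
    and "x1 + x2 + x3 + x4 + y1 + y2 + y3 + y4 = 2 * pi"
  shows "quad x1 x2 x3 x4 + quad y1 y2 y3 y4 \<le> 4 * lob (pi / 4)"
  using quad_add_le_large[of x1 x2 x3 x4 y1 y2 y3 y4] quad_add_le_large[of y1 y2 y3 y4 x1 x2 x3 x4] assms
  by (cases "pi \<le> x1 + x2 + x3 + x4") (auto simp: add_ac)

text \<open>The four cycles join one of {a1, a2}, {a3, a4} to one of {b1, b2}, {b3, b4}. Each vertex
  lies in two cycles and each edge in one, which explains the factor 1 / 2 in \<open>quad\<close>;
  complementary cycles share no vertex.\<close>

lemma bipartite_lob_le:
  assumes "0 \<le> a1" "0 \<le> a2" "0 \<le> a3" "0 \<le> a4" "0 \<le> b1" "0 \<le> b2" "0 \<le> b3" "0 \<le> b4"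
    and "a1 + a2 + a3 + a4 + b1 + b2 + b3 + b4 = 2 * pi"
  shows "lob a1 + lob a2 + lob a3 + lob a4 + lob b1 + lob b2 + lob b3 + lob b4
     - (lob (a1 + b1) + lob (a1 + b2) + lob (a1 + b3) + lob (a1 + b4)
      + lob (a2 + b1) + lob (a2 + b2) + lob (a2 + b3) + lob (a2 + b4)
      + lob (a3 + b1) + lob (a3 + b2) + lob (a3 + b3) + lob (a3 + b4)
      + lob (a4 + b1) + lob (a4 + b2) + lob (a4 + b3) + lob (a4 + b4)) / 2 \<le> 8 * lob (pi / 4)"
    (is "?l \<le> _")
proof -
  have "quad a1 b1 a2 b2 + quad a3 b3 a4 b4 \<le> 4 * lob (pi / 4)"
    using assms by (intro quad_add_le) auto
  moreover have "quad a1 b3 a2 b4 + quad a3 b1 a4 b2 \<le> 4 * lob (pi / 4)"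
    using assms by (intro quad_add_le) auto
  moreover have "?l = quad a1 b1 a2 b2 + quad a3 b3 a4 b4 + quad a1 b3 a2 b4 + quad a3 b1 a4 b2"
    by (simp add: quad_def add_ac add_divide_distrib diff_divide_distrib)
  ultimately show ?thesis by simp
qed

section \<open>Sums of logarithms of sines\<close>

lemma le_two_sin:
  fixes t :: real
  assumes "0 \<le> t" "t \<le> pi / 3"
  shows "t \<le> 2 * sin t"
proof -
  have "2 * sin 0 - 0 \<le> 2 * sin t - t"
  proof (rule DERIV_nonneg_imp_nondecreasing[OF assms(1)])
    fix u assume "0 \<le> u" "u \<le> t"
    then have "cos (pi / 3) \<le> cos u" using assms by (intro cos_monotone_0_pi_le) auto
    then have "0 \<le> 2 * cos u - 1" by (simp add: cos_60)
    moreover have "((\<lambda>u. 2 * sin u - u) has_real_derivative 2 * cos u - 1) (at u)"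
      by (auto intro!: derivative_eq_intros)
    ultimately show "\<exists>y. ((\<lambda>u. 2 * sin u - u) has_real_derivative y) (at u) \<and> 0 \<le> y" by blast
  qed
  then show ?thesis by simp
qed

text \<open>Since t is at most 2 sin t, the integrand -ln (2 sin t) is at most -ln t, whose
  antiderivative is t (1 - ln t). At x of order 1 / r this makes lob x / x of order ln r, the origin
  of the logarithmic error.\<close>

lemma lob_le_log:
  assumes "0 < x" "x \<le> pi / 3"
  shows "lob x \<le> x * (1 - ln x)"
proof -
  define f where "f t = t * (1 - ln t) - lob t" for t
  \<comment> \<open>The comparison starts at e > 0 to stay away from ln 0; e then tends to 0, and e
    < 1 makes e (1 - ln e) nonnegative.\<close>
  have "- lob e \<le> f x" if e: "0 < e" "e < x" "e < 1" for e
  proof -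
    have "f e \<le> f x"
    proof (rule mono_except_finite[where f = f and S = "{}" and g = "\<lambda>t. ln \<bar>2 * sin t\<bar> - ln t"])
      fix t assume "e < t" "t < x"
      then have t: "0 < t" "t \<le> pi / 3" using assms e by auto
      then have p: "sin t > 0" by (intro sin_gt_zero) auto
      show "(f has_real_derivative ln \<bar>2 * sin t\<bar> - ln t) (at t)"
        unfolding f_def using p t by (auto intro!: derivative_eq_intros)
      show "0 \<le> ln \<bar>2 * sin t\<bar> - ln t" using p t le_two_sin[of t] by simp
    qed (use assms e in \<open>auto simp: f_def intro!: continuous_intros\<close>)
    moreover have "0 \<le> e * (1 - ln e)"
    proof -
      have "ln e \<le> 0" using e by simp
      then have "0 \<le> 1 - ln e" by linarith
      then show ?thesis using e by (intro mult_nonneg_nonneg) auto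
    qed
    ultimately show ?thesis by (simp add: f_def)
  qed
  then have "eventually (\<lambda>e. - lob e \<le> f x) (at_right 0)"
    using assms by (auto simp: eventually_at_right_field intro!: exI[of _ "min x 1"])
  moreover have "((\<lambda>e. - lob e) \<longlongrightarrow> - lob 0) (at_right 0)"
  proof -
    have "isCont lob 0"
      using continuous_on_lob[of UNIV "\<lambda>x. x"] by (simp add: continuous_on_eq_continuous_at)
    then show ?thesis
      by (intro tendsto_minus) (simp add: isCont_def filterlim_at_split)
  qed
  ultimately have "- lob 0 \<le> f x"
    by (intro tendsto_upperbound) auto
  then show ?thesis by (simp add: f_def)
qed

section \<open>Quadrature rules for the logarithm of the sine\<close>

definition ln2sin :: "real \<Rightarrow> real" where "ln2sin x = ln \<bar>2 * sin x\<bar>"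

text \<open>The right-hand side is the integral of \<open>ln2sin\<close> over the cell, and the
  integrand is concave. The defect of the rule is nondecreasing as the cell grows symmetrically
  about its centre c.\<close>

lemma ln2sin_trapezoid:
  assumes "0 < h" "0 < a" "a + h < pi"
  shows "h * (ln2sin a + ln2sin (a + h)) / 2 \<le> lob a - lob (a + h)"
proof -
  define c where "c = a + h / 2"
  define f where "f t = lob (c - t) - lob (c + t) - t * (ln2sin (c - t) + ln2sin (c + t))" for t
  have p: "sin (c - t) > 0" "sin (c + t) > 0" if "0 \<le> t" "t \<le> h / 2" for t
    using that assms by (auto simp: c_def intro!: sin_gt_zero)
  have "f 0 \<le> f (h / 2)"
  proof (rule DERIV_nonneg_imp_nondecreasing[where f = f])
    fix t assume t: "0 \<le> t" "t \<le> h / 2"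
    note p = p[OF t]
    have "(f has_real_derivative t * (cot (c - t) - cot (c + t))) (at t)"
    proof -
      have "((\<lambda>t. ln2sin (c - t)) has_real_derivative cot (c - t) * (- 1)) (at t)"
        "((\<lambda>t. ln2sin (c + t)) has_real_derivative cot (c + t) * 1) (at t)"
        unfolding ln2sin_def using p
        by (intro DERIV_ln_2sin; auto intro!: derivative_eq_intros)+
      moreover have "((\<lambda>t. lob (c - t)) has_real_derivative ln2sin (c - t)) (at t)"
        "((\<lambda>t. lob (c + t)) has_real_derivative - ln2sin (c + t)) (at t)"
        unfolding ln2sin_def using p by (auto intro!: derivative_eq_intros)
      ultimately have "(f has_real_derivative (ln2sin (c - t) - - ln2sin (c + t))
          - (1 * (ln2sin (c - t) + ln2sin (c + t)) + (cot (c - t) * (- 1) + cot (c + t) * 1) * t)) (at t)"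
        unfolding f_def by (intro DERIV_diff DERIV_mult DERIV_add DERIV_ident)
      then show ?thesis by (simp add: algebra_simps)
    qed
    moreover have "0 \<le> t * (cot (c - t) - cot (c + t))"
    proof -
      have "cot (c - t) - cot (c + t) = sin (2 * t) / (sin (c - t) * sin (c + t))"
        using p sin_diff[of "c + t" "c - t"] by (simp add: cot_def field_simps)
      moreover have "0 \<le> sin (2 * t)" using t assms by (intro sin_ge_zero) auto
      ultimately show ?thesis using p t by simp
    qed
    ultimately show "\<exists>y. (f has_real_derivative y) (at t) \<and> 0 \<le> y" by blast
  qed (use assms in simp)
  moreover have "c - h / 2 = a" "c + h / 2 = a + h" by (simp_all add: c_def)
  ultimately show ?thesis by (simp add: f_def)
qed

text \<open>Concavity in the form sin (a - t) sin (a + t) = (sin a)^2 - (sin t)^2. Unlike a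
  trapezoid, the cell may touch the singularities 0 and pi, because only its centre is
  evaluated.\<close>

lemma ln2sin_midpoint:
  assumes "0 < h" "0 \<le> a - h / 2" "a + h / 2 \<le> pi"
  shows "lob (a - h / 2) - lob (a + h / 2) \<le> h * ln2sin a"
proof -
  define f where "f t = 2 * t * ln2sin a - lob (a - t) + lob (a + t)" for t
  have "f 0 \<le> f (h / 2)"
  proof (rule mono_except_finite[where f = f and S = "{}"
        and g = "\<lambda>t. 2 * ln2sin a - ln2sin (a - t) - ln2sin (a + t)"])
    fix t assume t: "0 < t" "t < h / 2"
    have p: "sin (a - t) > 0" "sin (a + t) > 0" "sin a > 0"
      using t assms by (auto intro!: sin_gt_zero)
    show "(f has_real_derivative 2 * ln2sin a - ln2sin (a - t) - ln2sin (a + t)) (at t)"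
      unfolding f_def using p by (auto intro!: derivative_eq_intros simp: ln2sin_def)
    have "(2 * sin (a - t)) * (2 * sin (a + t)) = 4 * ((sin a)\<^sup>2 * (cos t)\<^sup>2 - (cos a)\<^sup>2 * (sin t)\<^sup>2)"
      by (simp add: sin_add sin_diff power2_eq_square algebra_simps)
    also have "\<dots> = 4 * ((sin a)\<^sup>2 - (sin t)\<^sup>2)"
      using sin_cos_squared_add[of a] sin_cos_squared_add[of t] by algebra
    also have "\<dots> \<le> (2 * sin a)\<^sup>2" by (simp add: power_mult_distrib)
    finally have "ln ((2 * sin (a - t)) * (2 * sin (a + t))) \<le> ln ((2 * sin a)\<^sup>2)"
      using p by (subst ln_le_cancel_iff) auto
    then have "ln (2 * sin (a - t)) + ln (2 * sin (a + t)) \<le> 2 * ln (2 * sin a)"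
      using p by (simp add: ln_mult ln_realpow)
    then show "0 \<le> 2 * ln2sin a - ln2sin (a - t) - ln2sin (a + t)"
      using p by (simp add: ln2sin_def)
  qed (use assms in \<open>auto simp: f_def intro!: continuous_intros\<close>)
  then show ?thesis by (simp add: f_def)
qed

lemma ln2sin_le: "ln2sin x \<le> ln 2"
proof (cases "sin x = 0")
  case False
  have "\<bar>sin x\<bar> \<le> 1" by simp
  then show ?thesis using False unfolding ln2sin_def by (subst ln_le_cancel_iff) (auto simp: abs_mult)
qed (simp add: ln2sin_def)

text \<open>The trapezoid rule counts the first and the last term by half; each missing half is at
  most ln 2 / 2.\<close>

lemma sum_ln2sin_upper:
  assumes "0 < h" "0 < a" "a + real m * h < pi"
  shows "(\<Sum>k\<le>m. ln2sin (a + real k * h)) \<le> (lob a - lob (a + real m * h)) / h + ln 2"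
proof -
  have "(\<Sum>k\<le>m. ln2sin (a + real k * h)) 
     \<le> (lob a - lob (a + real m * h)) / h + ln2sin a / 2 + ln2sin (a + real m * h) / 2"
    using assms(3)
  proof (induction m)
    case (Suc m)
    have "a + real m * h < pi" using Suc.prems assms by (simp add: algebra_simps)
    note IH = Suc.IH[OF this]
    have e: "a + real m * h + h = a + real (Suc m) * h" by (simp add: algebra_simps)
    have "h * (ln2sin (a + real m * h) + ln2sin (a + real (Suc m) * h)) / 2
            \<le> lob (a + real m * h) - lob (a + real (Suc m) * h)"
    proof (rule ln2sin_trapezoid[of h "a + real m * h", unfolded e])
      have "0 \<le> real m * h" using assms by simp
      then show "0 < a + real m * h" using assms by linarith
    qed (use Suc.prems assms in auto)
    then have "(ln2sin (a + real m * h) + ln2sin (a + real (Suc m) * h)) / 2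
            \<le> (lob (a + real m * h) - lob (a + real (Suc m) * h)) / h"
      using assms by (simp add: field_simps)
    with IH show ?case by (simp add: diff_divide_distrib add_divide_distrib del: of_nat_Suc)
  qed simp
  then show ?thesis
    using ln2sin_le[of a] ln2sin_le[of "a + real m * h"] by simp
qed

lemma sum_ln2sin_lower:
  assumes "0 < h" "0 \<le> a - h / 2" "a + real m * h + h / 2 \<le> pi"
  shows "(lob (a - h / 2) - lob (a + real m * h + h / 2)) / h \<le> (\<Sum>k\<le>m. ln2sin (a + real k * h))"
  using assms(3)
proof (induction m)
  case 0
  then show ?case using ln2sin_midpoint[of h a] assms by (simp add: field_simps)
next
  case (Suc m)
  have "a + real m * h + h / 2 \<le> pi" using Suc.prems assms by (simp add: algebra_simps)
  note IH = Suc.IH[OF this]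
  have e: "a + real (Suc m) * h - h / 2 = a + real m * h + h / 2" by (simp add: algebra_simps)
  have "0 \<le> real m * h" using assms by simp
  then have "lob (a + real m * h + h / 2) - lob (a + real (Suc m) * h + h / 2)
          \<le> h * ln2sin (a + real (Suc m) * h)"
    using ln2sin_midpoint[of h "a + real (Suc m) * h", unfolded e] Suc.prems assms e by linarith
  then have "(lob (a + real m * h + h / 2) - lob (a + real (Suc m) * h + h / 2)) / h
          \<le> ln2sin (a + real (Suc m) * h)"
    using assms by (simp add: field_simps)
  with IH show ?case by (simp add: diff_divide_distrib del: of_nat_Suc)
qed


text \<open>Since \<open>r = 2 N + 1\<close> is odd, \<open>h N = \<pi> - h / 2\<close>: the cells of the midpoint rule around the first
  \<open>N\<close> points end exactly at the singularity \<open>\<pi>\<close>, where those around the remaining points begin.\<close>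
lemma sum_ln2sin_bounds:
  fixes r n :: nat
  defines "h \<equiv> 2 * pi / real r"
  assumes r: "odd r" "7 \<le> r" and n: "n < r"
  shows "- lob (h * real n) / h \<le> (\<Sum>i=1..n. ln2sin (h * real i))"
    and "(\<Sum>i=1..n. ln2sin (h * real i)) \<le> - lob (h * real n) / h + 5 * ln (real r)"
proof -
  obtain N where N: "r = 2 * N + 1" using r by (auto elim: oddE)
  have h: "0 < h" using r by (simp add: h_def)
  \<comment> \<open>This is the range of \<open>lob_le_log\<close> and the reason for assuming that
    r is at least 7.\<close>
  have h2: "h \<le> pi / 3" using r by (simp add: h_def field_simps)
  have hr: "h * real r = 2 * pi" using r by (simp add: h_def)
  then have hN: "h * real N = pi - h / 2" by (simp add: N algebra_simps)
  have N1: "1 \<le> N" using r N by simp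
  define S where "S n = (\<Sum>i=1..n. ln2sin (h * real i))" for n
  \<comment> \<open>For n > N the first N terms cost lob h / h + ln 2 and have main term lob (h / 2)
    / h; the terms past pi cost another lob (h / 2) / h + ln 2.\<close>
  define K where "K = (lob h + 2 * lob (h / 2)) / h + 2 * ln 2"
  have nn: "0 \<le> lob (h / 2)" using h h2 by (intro lob_nonneg) auto
  have K: "K \<le> 5 * ln (real r)"
  proof -
    have "lob h / h \<le> 1 - ln h" "2 * lob (h / 2) / h \<le> 1 - ln (h / 2)"
      using lob_le_log[of h] lob_le_log[of "h / 2"] h h2 by (auto simp: field_simps)
    then have "K \<le> 2 - 2 * ln h + 3 * ln 2"
      using h by (simp add: K_def add_divide_distrib ln_div)
    also have "ln h = ln 2 + ln pi - ln (real r)"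
      using r by (simp add: h_def ln_div ln_mult)
    finally have "K \<le> 2 + 2 * ln (real r) + ln 2 - 2 * ln pi" by simp
    moreover have "1 \<le> ln pi" "ln 2 \<le> ln pi" "ln pi \<le> ln (real r)"
    proof -
      have "exp 1 \<le> pi" using exp_le pi_gt3 by linarith
      then show "1 \<le> ln pi" by (subst ln_ge_iff) auto
      show "ln 2 \<le> ln pi" using pi_gt3 by simp
      show "ln pi \<le> ln (real r)" using pi_less_4 r by simp
    qed
    ultimately show ?thesis by linarith
  qed
  have shift: "(\<Sum>i=1..Suc m. ln2sin (h * real i)) = (\<Sum>k\<le>m. ln2sin (h + real k * h))" for m
    by (induction m) (simp_all add: algebra_simps)
  have small: "- lob (h * real n) / h \<le> S n" "S n \<le> - lob (h * real n) / h + (lob h / h + ln 2)"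
     "1 \<le> n \<Longrightarrow> (lob (h / 2) - lob (h * real n + h / 2)) / h \<le> S n"
    if "n \<le> N" for n
  proof -
    have hn: "h * real n \<le> pi - h / 2" unfolding hN[symmetric] using that h by simp
    have "- lob (h * real n) / h \<le> S n \<and> S n \<le> - lob (h * real n) / h + (lob h / h + ln 2) \<and>
      (1 \<le> n \<longrightarrow> (lob (h / 2) - lob (h * real n + h / 2)) / h \<le> S n)"
    proof (cases n)
      case 0
      have "0 \<le> lob h" using h h2 by (intro lob_nonneg) auto
      then show ?thesis using 0 h by (simp add: S_def)
    next
      case (Suc m)
      have e: "h + real m * h = h * real n" using Suc by (simp add: algebra_simps)
      have S: "S n = (\<Sum>k\<le>m. ln2sin (h + real k * h))" using shift[of m] Suc by (simp add: S_def)
      have up: "S n \<le> (lob h - lob (h * real n)) / h + ln 2"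
        using sum_ln2sin_upper[of h h m, unfolded e] h hn S by simp
      have lo: "(lob (h / 2) - lob (h * real n + h / 2)) / h \<le> S n"
        using sum_ln2sin_lower[of h h m, unfolded e] h hn S by simp
      \<comment> \<open>The first midpoint cell begins at h / 2 and the last one ends at h n + h /
        2. Subadditivity makes these two half cells compensate, so the lower bound has no error
        term.\<close>
      have "lob (h * real n + h / 2) \<le> lob (h * real n) + lob (h / 2)"
        using h hn by (intro lob_subadditive) auto
      then have "- lob (h * real n) / h \<le> (lob (h / 2) - lob (h * real n + h / 2)) / h"
        using h by (intro divide_right_mono) auto
      then show ?thesis using lo up by (auto simp: diff_divide_distrib)
    qed
    then show "- lob (h * real n) / h \<le> S n" "S n \<le> - lob (h * real n) / h + (lob h / h + ln 2)"
     "1 \<le> n \<Longrightarrow> (lob (h / 2) - lob (h * real n + h / 2)) / h \<le> S n" by auto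
  qed
  have "- lob (h * real n) / h \<le> S n \<and> S n \<le> - lob (h * real n) / h + K"
  proof (cases "n \<le> N")
    case True
    have "0 \<le> 2 * lob (h / 2) / h + ln 2" using nn h by simp
    then show ?thesis using small[OF True] by (simp add: K_def add_divide_distrib)
  next
    case False
    then obtain m where m: "n = N + 1 + m" using less_imp_Suc_add[of N n] by auto
    define y where "y = h / 2 + real m * h"
    have hn: "h * real n = y + pi" using hN by (simp add: m y_def algebra_simps)
    have hn2: "h * real n \<le> 2 * pi - h"
    proof -
      have "h * (real n + 1) \<le> h * real r" using n h by (intro mult_left_mono) auto
      then show ?thesis using hr by (simp add: algebra_simps)
    qed
    have "S (N + 1 + m) = S N + (\<Sum>k\<le>m. ln2sin (h / 2 + real k * h))"
    proof (induction m)
      case 0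
      have "h * real (N + 1) = h / 2 + pi" using hN by (simp add: algebra_simps)
      then show ?case by (simp add: S_def ln2sin_def)
    next
      case (Suc m)
      have "h * real (N + 1 + Suc m) = h / 2 + real (Suc m) * h + pi" using hN by (simp add: algebra_simps)
      then have "ln2sin (h * real (N + 1 + Suc m)) = ln2sin (h / 2 + real (Suc m) * h)"
        by (simp add: ln2sin_def del: of_nat_Suc)
      then show ?case using Suc by (simp add: S_def del: of_nat_Suc)
    qed
    then have S: "S n = S N + (\<Sum>k\<le>m. ln2sin (h / 2 + real k * h))" by (simp add: m)
    have "(lob 0 - lob (y + h / 2)) / h \<le> (\<Sum>k\<le>m. ln2sin (h / 2 + real k * h))"
      using sum_ln2sin_lower[of h "h / 2" m] h hn hn2 by (simp add: y_def)
    moreover have "lob (h / 2) / h \<le> S N" using small(3)[of N] N1 hN by simp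
    moreover have "- lob y / h \<le> lob (h / 2) / h + (lob 0 - lob (y + h / 2)) / h"
    proof -
      have "lob (y + h / 2) \<le> lob y + lob (h / 2)"
        using h hn hn2 by (intro lob_subadditive) (auto simp: y_def)
      then have "- lob y / h \<le> (lob (h / 2) + (lob 0 - lob (y + h / 2))) / h"
        using h by (intro divide_right_mono) auto
      then show ?thesis by (simp only: add_divide_distrib)
    qed
    ultimately have lo: "- lob (h * real n) / h \<le> S n" unfolding S hn lob_plus_pi by linarith
    have "(\<Sum>k\<le>m. ln2sin (h / 2 + real k * h)) \<le> (lob (h / 2) - lob y) / h + ln 2"
      using sum_ln2sin_upper[of h "h / 2" m] h hn hn2 by (simp add: y_def)
    moreover have "S N \<le> lob (h / 2) / h + (lob h / h + ln 2)" using small(2)[of N] hN by simp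
    ultimately have "S n \<le> - lob (h * real n) / h + K"
      unfolding S hn lob_plus_pi by (simp add: K_def add_divide_distrib diff_divide_distrib)
    with lo show ?thesis by simp
  qed
  then show "- lob (h * real n) / h \<le> (\<Sum>i=1..n. ln2sin (h * real i))"
    "(\<Sum>i=1..n. ln2sin (h * real i)) \<le> - lob (h * real n) / h + 5 * ln (real r)"
    using K by (simp_all add: S_def)
qed

section \<open>Quantum factorials and the quantum 6j-symbol\<close>

lemma norm_qint: "cmod (qint r (int i)) = \<bar>2 * sin (2 * pi / real r * real i)\<bar>"
proof -
  have q: "root_q r = cis (2 * pi / real r)"
    by (simp add: root_q_def cis_conv_exp mult_ac)
  have "qint r (int i) = cis (2 * pi / real r * real i) - cis (- (2 * pi / real r * real i))"
    unfolding qint_def q by (simp add: power_int_minus Complex.DeMoivre cis_inverse mult_ac)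
  also have "\<dots> = Complex 0 (2 * sin (2 * pi / real r * real i))"
    by (simp add: complex_eq_iff)
  finally show ?thesis
    using complex_norm[of 0 "2 * sin (2 * pi / real r * real i)"] by (simp only: real_sqrt_abs power_zero_numeral add_0)
qed

text \<open>Since r is odd, 2 i is no multiple of r; reduced modulo r it is some k with 0 < k < r,
  and sin (pi k / r) is at least sin (pi / r).\<close>

lemma norm_qint_ge:
  assumes r: "odd r" "3 \<le> r" and i: "0 < i" "i < r"
  shows "1 / real r \<le> cmod (qint r (int i))"
proof -
  have base: "1 / real r \<le> 2 * sin (pi / real r * real k)" if k: "0 < k" "k < r" for k
  proof -
    have p: "1 / real r \<le> 2 * sin (pi / real r)"
    proof -
      have "pi / real r \<le> 2 * sin (pi / real r)" using r by (intro le_two_sin) (auto simp: field_simps)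
      moreover have "1 / real r \<le> pi / real r" using pi_gt3 r by (intro divide_right_mono) auto
      ultimately show ?thesis by linarith
    qed
    have mono: "sin (pi / real r) \<le> sin (pi / real r * real j)" if "0 < j" "2 * j \<le> r" for j
    proof (rule sin_monotone_2pi_le)
      show "pi / real r * real j \<le> pi / 2" using that r by (simp add: field_simps)
      show "pi / real r \<le> pi / real r * real j" using that r by (simp add: field_simps)
      have "0 \<le> pi / real r" by simp
      then show "- (pi / 2) \<le> pi / real r" using pi_gt_zero by linarith
    qed
    show ?thesis
    proof (cases "2 * k \<le> r")
      case True
      with mono[of k] k p show ?thesis by simp
    next
      case False
      have "pi / real r * real (r - k) = pi - pi / real r * real k"
        using k by (simp add: of_nat_diff field_simps)
      then have e: "sin (pi / real r * real (r - k)) = sin (pi / real r * real k)" by simp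
      have "0 < r - k" "2 * (r - k) \<le> r" using k False by auto
      from mono[OF this, unfolded e] p show ?thesis by linarith
    qed
  qed
  show ?thesis
  proof (cases "2 * i < r")
    case True
    have e: "2 * pi / real r * real i = pi / real r * real (2 * i)" by simp
    show ?thesis using base[of "2 * i"] i True unfolding norm_qint e by linarith
  next
    case False
    then have "r < 2 * i" using r by (metis dvd_triv_left linorder_neqE_nat)
    then have k: "0 < 2 * i - r" "2 * i - r < r" using i by auto
    have "2 * pi / real r * real i = pi / real r * real (2 * i - r) + pi"
      using \<open>r < 2 * i\<close> r by (simp add: of_nat_diff field_simps)
    then have "\<bar>2 * sin (2 * pi / real r * real i)\<bar> = \<bar>2 * sin (pi / real r * real (2 * i - r))\<bar>"
      by (simp only: sin_periodic_pi abs_minus_cancel mult_minus_right)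
    then show ?thesis using base[OF k] unfolding norm_qint by linarith
  qed
qed

lemma norm_qfact_pos:
  assumes "odd r" "3 \<le> r" "n < r"
  shows "0 < cmod (qfact r n)"
proof -
  have "0 < cmod (qint r (int i))" if "i \<in> {1..n}" for i
  proof -
    have "0 < 1 / real r" using assms by simp
    also have "\<dots> \<le> cmod (qint r (int i))" using that assms by (intro norm_qint_ge) auto
    finally show ?thesis .
  qed
  then show ?thesis unfolding qfact_def prod_norm[symmetric] by (intro prod_pos) auto
qed

text \<open>The factor {r} vanishes. This removes the summands with z + 1 >= r from the
  symbol.\<close>

lemma qfact_eq_0:
  assumes "0 < r" "r \<le> n"
  shows "qfact r n = 0"
proof -
  have "cmod (qint r (int r)) = 0" unfolding norm_qint using assms by simp
  then show ?thesis unfolding qfact_def using assms by (intro prod_zero) (auto intro!: bexI[of _ r])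
qed

definition lnqfact :: "nat \<Rightarrow> nat \<Rightarrow> real" where
  "lnqfact r n = ln (cmod (qfact r n))"

lemma norm_qfact:
  assumes "odd r" "3 \<le> r" "n < r"
  shows "cmod (qfact r n) = exp (lnqfact r n)"
  using norm_qfact_pos[OF assms] by (simp add: lnqfact_def)

lemma lnqfact_eq_sum:
  assumes "odd r" "3 \<le> r" "n < r"
  shows "lnqfact r n = (\<Sum>i=1..n. ln2sin (2 * pi / real r * real i))"
proof -
  have p: "0 < cmod (qint r (int i))" if "i \<in> {1..n}" for i
  proof -
    have "0 < 1 / real r" using assms by simp
    also have "\<dots> \<le> cmod (qint r (int i))" using that assms by (intro norm_qint_ge) auto
    finally show ?thesis .
  qed
  have "lnqfact r n = (\<Sum>i=1..n. ln (cmod (qint r (int i))))"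
    unfolding lnqfact_def qfact_def prod_norm[symmetric] by (intro ln_prod) (use p in auto)
  then show ?thesis by (simp add: norm_qint ln2sin_def)
qed

text \<open>Used to pass from {z+1}! and {T+1}! to {z}! and {T}!, whose arguments fit the
  angles.\<close>

lemma lnqfact_Suc:
  assumes "odd r" "3 \<le> r" "Suc n < r"
  shows "lnqfact r (Suc n) \<le> lnqfact r n + ln 2" "lnqfact r n - ln (real r) \<le> lnqfact r (Suc n)"
proof -
  have e: "lnqfact r (Suc n) = lnqfact r n + ln2sin (2 * pi / real r * real (Suc n))"
    using assms by (simp add: lnqfact_eq_sum)
  then show "lnqfact r (Suc n) \<le> lnqfact r n + ln 2" using ln2sin_le by simp
  have "1 / real r \<le> \<bar>2 * sin (2 * pi / real r * real (Suc n))\<bar>"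
    using norm_qint_ge[of r "Suc n"] assms unfolding norm_qint by simp
  then have "ln (1 / real r) \<le> ln2sin (2 * pi / real r * real (Suc n))"
    unfolding ln2sin_def using assms by (intro ln_mono) auto
  then show "lnqfact r n - ln (real r) \<le> lnqfact r (Suc n)" using e assms by (simp add: ln_div)
qed

lemma lnqfact_bounds:
  assumes "odd r" "7 \<le> r" "n < r"
  shows "- lnqfact r n \<le> real r / (2 * pi) * lob (2 * pi / real r * real n)"
    and "lnqfact r n \<le> - (real r / (2 * pi)) * lob (2 * pi / real r * real n) + 5 * ln (real r)"
  using sum_ln2sin_bounds[of r n] lnqfact_eq_sum[of r n] assms by (simp_all add: mult_ac)

text \<open>The constant 38: twelve numerators of the Delta's at 5 / 2 each, four denominators at 1
  / 2 each, and 5 + 1 for {z+1}!. The factorials of z - T and Q - z enter through the error-free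
  bound.\<close>

lemma sixj_exponent_le:
  fixes r T1 T2 T3 T4 Q1 Q2 Q3 z :: nat
  assumes r: "odd r" "7 \<le> r"
    and T: "T1 \<le> z" "T2 \<le> z" "T3 \<le> z" "T4 \<le> z" and Q: "z \<le> Q1" "z \<le> Q2" "z \<le> Q3"
    and z: "z + 1 < r"
    and QT: "Q1 < r + T1" "Q1 < r + T2" "Q1 < r + T3" "Q1 < r + T4"
      "Q2 < r + T1" "Q2 < r + T2" "Q2 < r + T3" "Q2 < r + T4"
      "Q3 < r + T1" "Q3 < r + T2" "Q3 < r + T3" "Q3 < r + T4"
    and sum: "T1 + T2 + T3 + T4 = Q1 + Q2 + Q3"
  defines "e \<equiv> lnqfact r"
  shows "e (z + 1) - (e (z - T1) + e (z - T2) + e (z - T3) + e (z - T4))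
      - (e (Q1 - z) + e (Q2 - z) + e (Q3 - z))
      + (e (Q1 - T1) + e (Q1 - T2) + e (Q1 - T3) + e (Q1 - T4)
       + e (Q2 - T1) + e (Q2 - T2) + e (Q2 - T3) + e (Q2 - T4)
       + e (Q3 - T1) + e (Q3 - T2) + e (Q3 - T3) + e (Q3 - T4)) / 2
      - (e (T1 + 1) + e (T2 + 1) + e (T3 + 1) + e (T4 + 1)) / 2
      \<le> real r / (2 * pi) * (8 * lob (pi / 4)) + 38 * ln (real r)"
proof -
  define h where "h = 2 * pi / real r"
  define L where "L = ln (real r)"
  define k where "k = real r / (2 * pi)"
  define \<alpha> where "\<alpha> T = h * real (z - T)" for T
  define \<beta> where "\<beta> Q = h * real (Q - z)" for Q
  define b4 where "b4 = 2 * pi - h * real z"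
  have h: "0 < h" using r by (simp add: h_def)
  have hr: "h * real r = 2 * pi" using r by (simp add: h_def)
  have k: "0 < k" using r by (simp add: k_def)
  have r3: "3 \<le> r" using r by simp
  have lo: "- e n \<le> k * lob (h * real n)" and up: "e n \<le> - k * lob (h * real n) + 5 * L" if "n < r" for n
    using lnqfact_bounds[OF r that] by (simp_all add: e_def k_def h_def L_def)
  have A: "- e (z - T) \<le> k * lob (\<alpha> T)" if "T \<le> z" for T
    using lo[of "z - T"] that z by (simp add: \<alpha>_def)
  have B: "- e (Q - z) \<le> k * lob (\<beta> Q)" if "z \<le> Q" "Q < r + T1" for Q
    using lo[of "Q - z"] that T by (simp add: \<beta>_def)
  have C: "e (Q - T) \<le> - k * lob (\<alpha> T + \<beta> Q) + 5 * L" if "T \<le> z" "z \<le> Q" "Q < r + T" for Q T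
  proof -
    have "\<alpha> T + \<beta> Q = h * real (Q - T)" using that by (simp add: \<alpha>_def \<beta>_def of_nat_diff algebra_simps)
    then show ?thesis using up[of "Q - T"] that by simp
  qed
  \<comment> \<open>The angle is h (r - T), and reflection at 2 pi changes the sign of
    \<open>lob\<close>: a factorial in the denominator thus looks like a numerator {Q - T}! with Q =
    r.\<close>
  have D: "- e (T + 1) \<le> - k * lob (\<alpha> T + b4) + L" if "T \<le> z" for T
  proof -
    have "\<alpha> T + b4 = 2 * pi - h * real T" using that by (simp add: \<alpha>_def b4_def of_nat_diff algebra_simps)
    then have "lob (\<alpha> T + b4) = - lob (h * real T)" by simp
    moreover have "- e (T + 1) \<le> - e T + L"
      using lnqfact_Suc(2)[OF r(1) r3, of T] that z by (simp add: e_def L_def)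
    ultimately show ?thesis using lo[of T] that z by simp
  qed
  have E: "e (z + 1) \<le> k * lob b4 + 5 * L + ln 2"
  proof -
    have "lob b4 = - lob (h * real z)" by (simp add: b4_def)
    moreover have "e (z + 1) \<le> e z + ln 2" using lnqfact_Suc(1)[OF r(1) r3, of z] z by (simp add: e_def)
    ultimately show ?thesis using up[of z] z by simp
  qed
  have "h * real z \<le> h * real r" using z h by (intro mult_left_mono) auto
  then have b4: "0 \<le> b4" unfolding b4_def hr by simp
  have nn: "0 \<le> \<alpha> T" "0 \<le> \<beta> T" for T using h by (simp_all add: \<alpha>_def \<beta>_def)
  have "\<alpha> T1 + \<alpha> T2 + \<alpha> T3 + \<alpha> T4 + \<beta> Q1 + \<beta> Q2 + \<beta> Q3 + b4 = 2 * pi"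
  proof -
    have "real T1 + real T2 + real T3 + real T4 = real Q1 + real Q2 + real Q3"
      using sum by (metis of_nat_add)
    then have "h * (real T1 + real T2 + real T3 + real T4) = h * (real Q1 + real Q2 + real Q3)" by simp
    then show ?thesis using T Q by (simp add: \<alpha>_def \<beta>_def b4_def of_nat_diff algebra_simps)
  qed
  note F = bipartite_lob_le[OF nn(1) nn(1) nn(1) nn(1) nn(2) nn(2) nn(2) b4 this]
  have L: "ln 2 \<le> L" using r by (simp add: L_def)
  note F' = mult_left_mono[OF F less_imp_le[OF k], unfolded distrib_left right_diff_distrib times_divide_eq_right]
  have "- e (z - T1) + - e (z - T2) + - e (z - T3) + - e (z - T4)
      \<le> k * lob (\<alpha> T1) + k * lob (\<alpha> T2) + k * lob (\<alpha> T3) + k * lob (\<alpha> T4)"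
    by (intro add_mono A T)
  moreover have "- e (Q1 - z) + - e (Q2 - z) + - e (Q3 - z)
      \<le> k * lob (\<beta> Q1) + k * lob (\<beta> Q2) + k * lob (\<beta> Q3)"
    by (intro add_mono B Q QT)
  moreover have "e (Q1 - T1) + e (Q1 - T2) + e (Q1 - T3) + e (Q1 - T4)
      + e (Q2 - T1) + e (Q2 - T2) + e (Q2 - T3) + e (Q2 - T4)
      + e (Q3 - T1) + e (Q3 - T2) + e (Q3 - T3) + e (Q3 - T4)
      \<le> (- k * lob (\<alpha> T1 + \<beta> Q1) + 5 * L) + (- k * lob (\<alpha> T2 + \<beta> Q1) + 5 * L)
      + (- k * lob (\<alpha> T3 + \<beta> Q1) + 5 * L) + (- k * lob (\<alpha> T4 + \<beta> Q1) + 5 * L)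
      + (- k * lob (\<alpha> T1 + \<beta> Q2) + 5 * L) + (- k * lob (\<alpha> T2 + \<beta> Q2) + 5 * L)
      + (- k * lob (\<alpha> T3 + \<beta> Q2) + 5 * L) + (- k * lob (\<alpha> T4 + \<beta> Q2) + 5 * L)
      + (- k * lob (\<alpha> T1 + \<beta> Q3) + 5 * L) + (- k * lob (\<alpha> T2 + \<beta> Q3) + 5 * L)
      + (- k * lob (\<alpha> T3 + \<beta> Q3) + 5 * L) + (- k * lob (\<alpha> T4 + \<beta> Q3) + 5 * L)"
    by (intro add_mono C T Q QT)
  moreover have "- e (T1 + 1) + - e (T2 + 1) + - e (T3 + 1) + - e (T4 + 1)
      \<le> (- k * lob (\<alpha> T1 + b4) + L) + (- k * lob (\<alpha> T2 + b4) + L)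
        + (- k * lob (\<alpha> T3 + b4) + L) + (- k * lob (\<alpha> T4 + b4) + L)"
    by (intro add_mono D T)
  ultimately show ?thesis
    using F' E L unfolding L_def[symmetric] k_def[symmetric] by argo
qed

lemma norm_Delta:
  assumes r: "odd r" "3 \<le> r"
    and xyz: "(a + b - c) div 2 = x" "(a + c - b) div 2 = y" "(b + c - a) div 2 = w" "(a + b + c) div 2 = T"
    and lt: "x < r" "y < r" "w < r" "T + 1 < r"
  shows "cmod (Delta r a b c) = sqrt (zeta_r r)
     * exp ((lnqfact r x + lnqfact r y + lnqfact r w - lnqfact r (T + 1)) / 2)"
proof -
  let ?E = "lnqfact r x + lnqfact r y + lnqfact r w - lnqfact r (T + 1)"
  have "0 \<le> zeta_r r"
  proof -
    have "2 * pi / real r \<le> pi" using r by (simp add: field_simps)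
    then show ?thesis unfolding zeta_r_def by (intro mult_nonneg_nonneg sin_ge_zero) auto
  qed
  then have "cmod (Delta r a b c) = sqrt (zeta_r r * exp ?E)"
    unfolding Delta_def xyz norm_csqrt
    using lt by (simp add: norm_mult norm_divide norm_qfact[OF r] exp_add exp_diff)
  moreover have "sqrt (exp ?E) = exp (?E / 2)"
    by (rule real_sqrt_unique) (simp_all add: exp_double[symmetric])
  ultimately show ?thesis by (simp add: real_sqrt_mult)
qed

lemma norm_quantum_6j_le:
  assumes r: "odd r" "7 \<le> r" and adm: "admissible r n1 n2 n3 n4 n5 n6"
  shows "cmod (quantum_6j r n1 n2 n3 n4 n5 n6)
     \<le> exp (real r / (2 * pi) * (8 * lob (pi / 4)) + 40 * ln (real r))"
proof -
  have r3: "3 \<le> r" using r by simp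
  note adm = adm[unfolded admissible_def admissible_triple_def]
  from adm have le: "n1 + 2 \<le> r" "n2 + 2 \<le> r" "n3 + 2 \<le> r" "n4 + 2 \<le> r" "n5 + 2 \<le> r" "n6 + 2 \<le> r"
    and tri: "n1 \<le> n2 + n3" "n2 \<le> n1 + n3" "n3 \<le> n1 + n2" "n1 \<le> n5 + n6" "n5 \<le> n1 + n6" "n6 \<le> n1 + n5"
      "n2 \<le> n4 + n6" "n4 \<le> n2 + n6" "n6 \<le> n2 + n4" "n3 \<le> n4 + n5" "n4 \<le> n3 + n5" "n5 \<le> n3 + n4"
    and ev: "even (n1 + n2 + n3)" "even (n1 + n5 + n6)" "even (n2 + n4 + n6)" "even (n3 + n4 + n5)"
    and sm: "n1 + n2 + n3 + 4 \<le> 2 * r" "n1 + n5 + n6 + 4 \<le> 2 * r" "n2 + n4 + n6 + 4 \<le> 2 * r" "n3 + n4 + n5 + 4 \<le> 2 * r"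
    by blast+
  obtain T1 where T1: "n1 + n2 + n3 = 2 * T1" using ev(1) by (rule evenE)
  obtain T2 where T2: "n1 + n5 + n6 = 2 * T2" using ev(2) by (rule evenE)
  obtain T3 where T3: "n2 + n4 + n6 = 2 * T3" using ev(3) by (rule evenE)
  obtain T4 where T4: "n3 + n4 + n5 = 2 * T4" using ev(4) by (rule evenE)
  note T = T1 T2 T3 T4
  \<comment> \<open>The triples of T1 and T4 share only n3, so Q1 = T1 + T4 - n3; this yields the
    parity of the sum.\<close>
  obtain Q1 where Q1: "n1 + n2 + n4 + n5 = 2 * Q1"
    using T by (intro that[of "T1 + T4 - n3"]) linarith
  obtain Q2 where Q2: "n1 + n3 + n4 + n6 = 2 * Q2"
    using T by (intro that[of "T1 + T3 - n2"]) linarith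
  obtain Q3 where Q3: "n2 + n3 + n5 + n6 = 2 * Q3"
    using T by (intro that[of "T1 + T2 - n1"]) linarith
  note Q = Q1 Q2 Q3
  have TQ: "T1 + T2 + T3 + T4 = Q1 + Q2 + Q3" using T Q by linarith
  have Tr: "T1 + 1 < r" "T2 + 1 < r" "T3 + 1 < r" "T4 + 1 < r" using T sm by linarith+
  have QT: "Q1 < r + T1" "Q1 < r + T2" "Q1 < r + T3" "Q1 < r + T4"
      "Q2 < r + T1" "Q2 < r + T2" "Q2 < r + T3" "Q2 < r + T4"
      "Q3 < r + T1" "Q3 < r + T2" "Q3 < r + T3" "Q3 < r + T4"
    using T Q le tri by linarith+
  have half: "m div 2 = Q - U" if "m + 2 * U = 2 * Q" for m Q U :: nat using that by linarith
  have lt: "Q - U < r" if "Q < r + U" for Q U :: nat using that r by linarith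
  \<comment> \<open>The half-differences of the i-th triple are differences Q_j - T_k with k running
    over the other three indices; all twelve pairs (j, k) occur once.\<close>
  have H11: "(n1 + n2 - n3) div 2 = Q1 - T4" by (rule half) (use Q1 T4 tri(3) in linarith)
  have H12: "(n1 + n3 - n2) div 2 = Q2 - T3" by (rule half) (use Q2 T3 tri(2) in linarith)
  have H13: "(n2 + n3 - n1) div 2 = Q3 - T2" by (rule half) (use Q3 T2 tri(1) in linarith)
  have H21: "(n1 + n5 - n6) div 2 = Q1 - T3" by (rule half) (use Q1 T3 tri(6) in linarith)
  have H22: "(n1 + n6 - n5) div 2 = Q2 - T4" by (rule half) (use Q2 T4 tri(5) in linarith)
  have H23: "(n5 + n6 - n1) div 2 = Q3 - T1" by (rule half) (use Q3 T1 tri(4) in linarith)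
  have H31: "(n2 + n4 - n6) div 2 = Q1 - T2" by (rule half) (use Q1 T2 tri(9) in linarith)
  have H32: "(n2 + n6 - n4) div 2 = Q3 - T4" by (rule half) (use Q3 T4 tri(8) in linarith)
  have H33: "(n4 + n6 - n2) div 2 = Q2 - T1" by (rule half) (use Q2 T1 tri(7) in linarith)
  have H41: "(n3 + n4 - n5) div 2 = Q2 - T2" by (rule half) (use Q2 T2 tri(12) in linarith)
  have H42: "(n3 + n5 - n4) div 2 = Q3 - T3" by (rule half) (use Q3 T3 tri(11) in linarith)
  have H43: "(n4 + n5 - n3) div 2 = Q1 - T1" by (rule half) (use Q1 T1 tri(10) in linarith)
  have HT: "(n1 + n2 + n3) div 2 = T1" "(n1 + n5 + n6) div 2 = T2" "(n2 + n4 + n6) div 2 = T3" "(n3 + n4 + n5) div 2 = T4"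
    using T by simp_all
  define e where "e = lnqfact r"
  define d1 where "d1 = (e (Q1 - T4) + e (Q2 - T3) + e (Q3 - T2) - e (T1 + 1)) / 2"
  define d2 where "d2 = (e (Q1 - T3) + e (Q2 - T4) + e (Q3 - T1) - e (T2 + 1)) / 2"
  define d3 where "d3 = (e (Q1 - T2) + e (Q3 - T4) + e (Q2 - T1) - e (T3 + 1)) / 2"
  define d4 where "d4 = (e (Q2 - T2) + e (Q3 - T3) + e (Q1 - T1) - e (T4 + 1)) / 2"
  have D1: "cmod (Delta r n1 n2 n3) = sqrt (zeta_r r) * exp d1"
    unfolding d1_def e_def
    by (rule norm_Delta[OF r(1) r3 H11 H12 H13 HT(1) lt[OF QT(4)] lt[OF QT(7)] lt[OF QT(10)] Tr(1)])
  have D2: "cmod (Delta r n1 n5 n6) = sqrt (zeta_r r) * exp d2"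
    unfolding d2_def e_def
    by (rule norm_Delta[OF r(1) r3 H21 H22 H23 HT(2) lt[OF QT(3)] lt[OF QT(8)] lt[OF QT(9)] Tr(2)])
  have D3: "cmod (Delta r n2 n4 n6) = sqrt (zeta_r r) * exp d3"
    unfolding d3_def e_def
    by (rule norm_Delta[OF r(1) r3 H31 H32 H33 HT(3) lt[OF QT(2)] lt[OF QT(12)] lt[OF QT(5)] Tr(3)])
  have D4: "cmod (Delta r n3 n4 n5) = sqrt (zeta_r r) * exp d4"
    unfolding d4_def e_def
    by (rule norm_Delta[OF r(1) r3 H41 H42 H43 HT(4) lt[OF QT(6)] lt[OF QT(11)] lt[OF QT(1)] Tr(4)])
  define B where "B = real r / (2 * pi) * (8 * lob (pi / 4)) + 38 * ln (real r)"
  define \<tau> where "\<tau> z = (- 1) ^ z * qfact r (z + 1) /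
           ((qfact r (z - T1) * qfact r (z - T2) * qfact r (z - T3) * qfact r (z - T4)) *
            (qfact r (Q1 - z) * qfact r (Q2 - z) * qfact r (Q3 - z)))" for z
  define Z where "Z = {Max {T1, T2, T3, T4}..Min {Q1, Q2, Q3}}"
  have \<tau>: "cmod (\<tau> z) \<le> exp (B - (d1 + d2 + d3 + d4))" if "z \<in> Z" for z
  proof (cases "z + 1 < r")
    case False
    then have "qfact r (z + 1) = 0" using r by (intro qfact_eq_0) auto
    then show ?thesis by (simp add: \<tau>_def)
  next
    case True
    from that have Tz: "T1 \<le> z" "T2 \<le> z" "T3 \<le> z" "T4 \<le> z" and zQ: "z \<le> Q1" "z \<le> Q2" "z \<le> Q3"
      by (auto simp: Z_def)
    have lt: "z + 1 < r" "z - T1 < r" "z - T2 < r" "z - T3 < r" "z - T4 < r" "Q1 - z < r" "Q2 - z < r" "Q3 - z < r"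
      using True QT Tz by linarith+
    have "cmod (\<tau> z) = exp (e (z + 1) - (e (z - T1) + e (z - T2) + e (z - T3) + e (z - T4))
            - (e (Q1 - z) + e (Q2 - z) + e (Q3 - z)))"
      unfolding \<tau>_def e_def
      using lt
      by (simp add: norm_mult norm_divide norm_power norm_qfact[OF r(1) r3] exp_add exp_diff divide_divide_eq_left)
    also have "\<dots> \<le> exp (B - (d1 + d2 + d3 + d4))"
      unfolding exp_le_cancel_iff
      using sixj_exponent_le[OF r Tz zQ True QT TQ, folded e_def B_def]
      unfolding d1_def d2_def d3_def d4_def by argo
    finally show ?thesis .
  qed
  \<comment> \<open>The range lies between T1 and Q1, and Q1 - T1 < r.\<close>
  have "card Z \<le> r" using QT(1) by (simp add: Z_def)
  have "cmod (\<Sum>z\<in>Z. \<tau> z) \<le> (\<Sum>z\<in>Z. cmod (\<tau> z))" by (rule norm_sum)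
  also have "\<dots> \<le> real (card Z) * exp (B - (d1 + d2 + d3 + d4))"
    using sum_bounded_above[of Z "\<lambda>z. cmod (\<tau> z)", OF \<tau>] by simp
  also have "\<dots> \<le> real r * exp (B - (d1 + d2 + d3 + d4))"
    using \<open>card Z \<le> r\<close> by (intro mult_right_mono) auto
  finally have S: "cmod (\<Sum>z\<in>Z. \<tau> z) \<le> real r * exp (B - (d1 + d2 + d3 + d4))" .
  define \<zeta> where "\<zeta> = zeta_r r"
  have \<zeta>: "0 < \<zeta>" "\<zeta> \<le> 2"
  proof -
    have "0 < 2 * pi / real r" "2 * pi / real r < pi" using r by (auto simp: field_simps)
    then show "0 < \<zeta>" unfolding \<zeta>_def zeta_r_def by (intro mult_pos_pos sin_gt_zero) auto
    show "\<zeta> \<le> 2" by (simp add: \<zeta>_def zeta_r_def)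
  qed
  have "(n1 + n2 + n3) div 2 = T1" "(n1 + n5 + n6) div 2 = T2" "(n2 + n4 + n6) div 2 = T3" "(n3 + n4 + n5) div 2 = T4"
    "(n1 + n2 + n4 + n5) div 2 = Q1" "(n1 + n3 + n4 + n6) div 2 = Q2" "(n2 + n3 + n5 + n6) div 2 = Q3"
    using T Q by simp_all
  then have "quantum_6j r n1 n2 n3 n4 n5 n6 = inverse (of_real \<zeta>) * \<i> ^ (n1 + n2 + n3 + n4 + n5 + n6) *
        (Delta r n1 n2 n3 * Delta r n1 n5 n6 * Delta r n2 n4 n6 * Delta r n3 n4 n5) * (\<Sum>z\<in>Z. \<tau> z)"
    by (simp only: quantum_6j_def Let_def \<zeta>_def Z_def \<tau>_def)
  then have "cmod (quantum_6j r n1 n2 n3 n4 n5 n6)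
      = inverse \<zeta> * ((sqrt \<zeta> * exp d1) * (sqrt \<zeta> * exp d2) * (sqrt \<zeta> * exp d3) * (sqrt \<zeta> * exp d4))
         * cmod (\<Sum>z\<in>Z. \<tau> z)"
    using \<zeta> D1 D2 D3 D4 by (simp add: norm_mult norm_inverse norm_power \<zeta>_def[symmetric])
  also have "\<dots> = inverse \<zeta> * ((sqrt \<zeta> * sqrt \<zeta>) * (sqrt \<zeta> * sqrt \<zeta>)) * exp (d1 + d2 + d3 + d4)
         * cmod (\<Sum>z\<in>Z. \<tau> z)"
    by (simp only: exp_add mult_ac)
  also have "\<dots> = \<zeta> * exp (d1 + d2 + d3 + d4) * cmod (\<Sum>z\<in>Z. \<tau> z)"
    using \<zeta> by simp
  also have "\<dots> \<le> \<zeta> * exp (d1 + d2 + d3 + d4) * (real r * exp (B - (d1 + d2 + d3 + d4)))"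
    using \<zeta> S by (intro mult_left_mono) auto
  also have "\<dots> = \<zeta> * real r * exp B"
    by (simp add: exp_diff)
  \<comment> \<open>Four roots of \<zeta> against one inverse leave a single \<zeta>, at most 2 and
    hence at most r. Together with the number of summands this raises 38 to 40.\<close>
  also have "\<dots> \<le> real r * real r * exp B"
    using \<zeta> r by (intro mult_right_mono) auto
  also have "\<dots> = exp (ln (real r) + ln (real r) + B)"
    using r by (simp only: exp_add) simp
  also have "ln (real r) + ln (real r) + B = real r / (2 * pi) * (8 * lob (pi / 4)) + 40 * ln (real r)"
    by (simp add: B_def)
  finally show ?thesis .
qed

lemma quantum_6j_log_le:
  assumes r: "odd r" "7 \<le> r" and adm: "admissible r n1 n2 n3 n4 n5 n6"
  shows "ereal (2 * pi / real r) * elog (cmod (quantum_6j r n1 n2 n3 n4 n5 n6))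
     \<le> ereal (8 * lob (pi / 4) + 80 * pi * (ln (real r) / real r))"
proof (cases "quantum_6j r n1 n2 n3 n4 n5 n6 = 0")
  case True
  have "ereal (2 * pi / real r) * - \<infinity> = - \<infinity>" using r by simp
  then show ?thesis using True by (simp add: elog_def)
next
  case False
  define x where "x = cmod (quantum_6j r n1 n2 n3 n4 n5 n6)"
  have x: "0 < x" using False by (simp add: x_def)
  have "ln x \<le> real r / (2 * pi) * (8 * lob (pi / 4)) + 40 * ln (real r)"
    using ln_mono[OF norm_quantum_6j_le[OF r adm, folded x_def] x] by simp
  then have "2 * pi / real r * ln x \<le> 2 * pi / real r * (real r / (2 * pi) * (8 * lob (pi / 4)) + 40 * ln (real r))"
    using r by (intro mult_left_mono) auto
  also have "\<dots> = 8 * lob (pi / 4) + 80 * pi * (ln (real r) / real r)"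
    using r by (simp add: field_simps)
  finally show ?thesis using x unfolding x_def[symmetric] by (simp add: elog_def)
qed

section \<open>The volume of the regular ideal octahedron\<close>

lemma nn_integral_even:
  fixes f :: "real \<Rightarrow> ennreal"
  assumes [measurable]: "f \<in> borel_measurable borel" and even: "\<And>x. f (- x) = f x"
  shows "(\<integral>\<^sup>+x. f x \<partial>lborel) = 2 * (\<integral>\<^sup>+x. f x * indicator {0<..} x \<partial>lborel)"
proof -
  have "(\<integral>\<^sup>+x. f x \<partial>lborel) = (\<integral>\<^sup>+x. f x * indicator {0<..} x + f x * indicator {..<0} x \<partial>lborel)"
    using AE_lborel_singleton[of "0::real"]
    by (intro nn_integral_cong_AE) (auto split: split_indicator elim!: eventually_mono)
  also have "\<dots> = (\<integral>\<^sup>+x. f x * indicator {0<..} x \<partial>lborel) + (\<integral>\<^sup>+x. f x * indicator {..<0} x \<partial>lborel)"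
    by (rule nn_integral_add) auto
  also have "(\<integral>\<^sup>+x. f x * indicator {..<0} x \<partial>lborel) = (\<integral>\<^sup>+x. f x * indicator {0<..} x \<partial>lborel)"
    by (subst nn_integral_real_affine[where c = "-1" and t = 0])
       (auto simp: even intro!: nn_integral_cong split: split_indicator)
  finally show ?thesis by (simp add: mult_2)
qed

lemma nn_integral_lborel_pair:
  fixes f :: "'a :: euclidean_space \<times> 'b :: euclidean_space \<Rightarrow> ennreal"
  assumes "f \<in> borel_measurable borel"
  shows "(\<integral>\<^sup>+p. f p \<partial>lborel) = (\<integral>\<^sup>+x. \<integral>\<^sup>+y. f (x, y) \<partial>lborel \<partial>lborel)"
  using lborel.nn_integral_fst[of f lborel] assms by (simp add: lborel_prod)

text \<open>No indicator of the open ball is needed: on the unit sphere the value is \<open>1 / 0 = 0\<close>.\<close>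
definition octa_density :: "real \<Rightarrow> real \<Rightarrow> real \<Rightarrow> real" where
  "octa_density x y z = (if \<bar>x\<bar> + \<bar>y\<bar> + \<bar>z\<bar> \<le> 1 then 1 / (1 - (x\<^sup>2 + y\<^sup>2 + z\<^sup>2))\<^sup>2 else 0)"

lemma measurable_octa_density [measurable]:
  assumes [measurable]: "f \<in> borel_measurable M" "g \<in> borel_measurable M" "h \<in> borel_measurable M"
  shows "(\<lambda>p. octa_density (f p) (g p) (h p)) \<in> borel_measurable M"
  unfolding octa_density_def by measurable

lemma octa_density_nonneg: "0 \<le> octa_density x y z"
  by (simp add: octa_density_def)

lemma convex_hull_octahedron:
  "convex hull (Basis \<union> uminus ` Basis) = {(x, y, z). \<bar>x\<bar> + \<bar>y\<bar> + \<bar>z\<bar> \<le> (1 :: real)}" (is "?H = ?O")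
proof
  let ?B = "Basis \<union> uminus ` Basis :: (real \<times> real \<times> real) set"
  have B: "?B = {(1, 0, 0), (0, 1, 0), (0, 0, 1), (-1, 0, 0), (0, -1, 0), (0, 0, -1)}"
    by (auto simp: Basis_prod_def zero_prod_def image_iff)
  have "convex ?O"
  proof (rule convexI)
    fix p p' :: "real \<times> real \<times> real" and u v :: real
    assume "p \<in> ?O" "p' \<in> ?O" and uv: "0 \<le> u" "0 \<le> v" "u + v = 1"
    then obtain x y z x' y' z' where p: "p = (x, y, z)" "p' = (x', y', z')"
      and le: "\<bar>x\<bar> + \<bar>y\<bar> + \<bar>z\<bar> \<le> 1" "\<bar>x'\<bar> + \<bar>y'\<bar> + \<bar>z'\<bar> \<le> 1" by auto
    have t: "\<bar>u * p + v * q\<bar> \<le> u * \<bar>p\<bar> + v * \<bar>q\<bar>" for p q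
      using abs_triangle_ineq[of "u * p" "v * q"] uv(1,2) by (simp add: abs_mult)
    have "\<bar>u * x + v * x'\<bar> + \<bar>u * y + v * y'\<bar> + \<bar>u * z + v * z'\<bar>
        \<le> (u * \<bar>x\<bar> + v * \<bar>x'\<bar>) + (u * \<bar>y\<bar> + v * \<bar>y'\<bar>) + (u * \<bar>z\<bar> + v * \<bar>z'\<bar>)"
      by (intro add_mono t)
    also have "\<dots> = u * (\<bar>x\<bar> + \<bar>y\<bar> + \<bar>z\<bar>) + v * (\<bar>x'\<bar> + \<bar>y'\<bar> + \<bar>z'\<bar>)"
      by (simp only: distrib_left add_ac)
    also have "\<dots> \<le> u * 1 + v * 1"
      by (intro add_mono mult_left_mono le uv)
    finally have "\<bar>u * x + v * x'\<bar> + \<bar>u * y + v * y'\<bar> + \<bar>u * z + v * z'\<bar> \<le> 1"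
      using uv(3) by simp
    then show "u *\<^sub>R p + v *\<^sub>R p' \<in> ?O" by (simp add: p)
  qed
  then show "?H \<subseteq> ?O" by (intro hull_minimal) (auto simp: B)
  show "?O \<subseteq> ?H"
  proof clarify
    fix x y z :: real assume le: "\<bar>x\<bar> + \<bar>y\<bar> + \<bar>z\<bar> \<le> 1"
    have sub: "?B \<subseteq> ?H" by (rule hull_subset)
    have axis: "c *\<^sub>R e \<in> ?H" if "e \<in> ?H" "- e \<in> ?H" "\<bar>c\<bar> \<le> 1" for c e
    proof -
      have "((1 + c) / 2) *\<^sub>R e + ((1 - c) / 2) *\<^sub>R (- e) \<in> ?H"
        by (rule convexD[OF convex_convex_hull that(1,2)]) (use that(3) in \<open>auto simp: field_simps\<close>)
      also have "((1 + c) / 2) *\<^sub>R e + ((1 - c) / 2) *\<^sub>R (- e) = c *\<^sub>R e"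
        unfolding scaleR_minus_right diff_conv_add_uminus[symmetric] scaleR_diff_left[symmetric]
        by (simp add: field_simps)
      finally show ?thesis .
    qed
    \<comment> \<open>The slack is shared equally, so that the weights |x| + t, |y| + t, |z| + t sum
      to 1.\<close>
    define t where "t = (1 - (\<bar>x\<bar> + \<bar>y\<bar> + \<bar>z\<bar>)) / 3"
    have t: "0 \<le> t" using le by (simp add: t_def)
    \<comment> \<open>If |p| + t = 0 then p = 0, and both claims hold because division by 0 gives
      0.\<close>
    have small: "\<bar>p / (\<bar>p\<bar> + t)\<bar> \<le> 1" "(\<bar>p\<bar> + t) * (p / (\<bar>p\<bar> + t)) = p" for p
      using t by (auto simp: abs_divide divide_le_eq_1)
    have sum1: "\<bar>x\<bar> + t + (\<bar>y\<bar> + t) + (\<bar>z\<bar> + t) = 1" by (simp add: t_def field_simps)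
    let ?S = "{(x / (\<bar>x\<bar> + t)) *\<^sub>R (1, 0, 0), (y / (\<bar>y\<bar> + t)) *\<^sub>R (0, 1, 0), (z / (\<bar>z\<bar> + t)) *\<^sub>R (0, 0, 1)}
      :: (real \<times> real \<times> real) set"
    have e: "(1, 0, 0) \<in> ?H" "- (1, 0, 0) \<in> ?H" "(0, 1, 0) \<in> ?H" "- (0, 1, 0) \<in> ?H"
       "(0, 0, 1) \<in> ?H" "- (0, 0, 1) \<in> ?H"
      using sub unfolding B by simp_all
    have sub': "convex hull ?S \<subseteq> ?H"
    proof (rule hull_minimal)
      show "?S \<subseteq> ?H"
        by (intro insert_subsetI empty_subsetI axis[OF e(1,2) small(1)] axis[OF e(3,4) small(1)] axis[OF e(5,6) small(1)])
    qed (rule convex_convex_hull)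
    have comb: "(\<bar>x\<bar> + t) *\<^sub>R ((x / (\<bar>x\<bar> + t)) *\<^sub>R (1, 0, 0)) + (\<bar>y\<bar> + t) *\<^sub>R ((y / (\<bar>y\<bar> + t)) *\<^sub>R (0, 1, 0))
       + (\<bar>z\<bar> + t) *\<^sub>R ((z / (\<bar>z\<bar> + t)) *\<^sub>R (0, 0, 1)) \<in> convex hull ?S"
      unfolding convex_hull_3
      by (intro CollectI exI[of _ "\<bar>x\<bar> + t"] exI[of _ "\<bar>y\<bar> + t"] exI[of _ "\<bar>z\<bar> + t"] conjI refl
          add_nonneg_nonneg abs_ge_zero t sum1)
    have "(\<bar>x\<bar> + t) *\<^sub>R ((x / (\<bar>x\<bar> + t)) *\<^sub>R (1, 0, 0)) + (\<bar>y\<bar> + t) *\<^sub>R ((y / (\<bar>y\<bar> + t)) *\<^sub>R (0, 1, 0))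
       + (\<bar>z\<bar> + t) *\<^sub>R ((z / (\<bar>z\<bar> + t)) *\<^sub>R (0, 0, 1)) = (x, y, z)"
      unfolding scaleR_scaleR small(2) by simp
    with subsetD[OF sub' comb] show "(x, y, z) \<in> ?H" by (simp only:)
  qed
qed

lemma emeasure_octahedron_cartesian:
  "emeasure hyperbolic_volume regular_ideal_octahedron
     = (\<integral>\<^sup>+x. \<integral>\<^sup>+y. \<integral>\<^sup>+z. octa_density x y z \<partial>lborel \<partial>lborel \<partial>lborel)"
proof -
  let ?f = "\<lambda>p :: real \<times> real \<times> real. ennreal (indicator (ball 0 1) p / (1 - (norm p)\<^sup>2)\<^sup>2)"
  let ?g = "\<lambda>(x, y, z). ennreal (octa_density x y z)"
  have m: "?g \<in> borel_measurable borel" 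
    unfolding borel_prod[symmetric] by measurable
  have "compact (convex hull (Basis \<union> uminus ` Basis) :: (real \<times> real \<times> real) set)"
    by (intro compact_convex_hull finite_imp_compact) auto
  then have O: "regular_ideal_octahedron \<in> sets lborel"
    unfolding regular_ideal_octahedron_def sets_lborel
    by (intro sets.Int borel_closed borel_open compact_imp_closed open_ball)
  have eq: "?f p * indicator regular_ideal_octahedron p = ?g p" for p
  proof -
    obtain x y z where p: "p = (x, y, z)" by (cases p) auto
    have n: "(norm p)\<^sup>2 = x\<^sup>2 + y\<^sup>2 + z\<^sup>2" by (simp add: p norm_Pair)
    show ?thesis
    proof (cases "\<bar>x\<bar> + \<bar>y\<bar> + \<bar>z\<bar> \<le> 1")
      case False
      then show ?thesis
        by (simp add: regular_ideal_octahedron_def convex_hull_octahedron p octa_density_def)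
    next
      case True
      have "(norm p)\<^sup>2 \<le> (\<bar>x\<bar> + \<bar>y\<bar> + \<bar>z\<bar>)\<^sup>2"
      proof -
        have "0 \<le> \<bar>x\<bar> * \<bar>y\<bar>" "0 \<le> \<bar>x\<bar> * \<bar>z\<bar>" "0 \<le> \<bar>y\<bar> * \<bar>z\<bar>" by auto
        then show ?thesis unfolding n by (simp add: power2_eq_square algebra_simps)
      qed
      also have "\<dots> \<le> 1\<^sup>2" using True by (intro power_mono) auto
      finally have "norm p \<le> 1" by (rule power2_le_imp_le) simp
      then consider "norm p < 1" | "norm p = 1" by linarith
      then show ?thesis
      proof cases
        case 1
        then show ?thesis using True n
          by (simp add: regular_ideal_octahedron_def convex_hull_octahedron p octa_density_def)
      next
        case 2
        then show ?thesis using True n[symmetric]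
          by (simp add: regular_ideal_octahedron_def p octa_density_def)
      qed
    qed
  qed
  have "emeasure hyperbolic_volume regular_ideal_octahedron
      = (\<integral>\<^sup>+p. ?f p * indicator regular_ideal_octahedron p \<partial>lborel)"
  proof -
    have "(\<lambda>p :: real \<times> real \<times> real. (1 - (norm p)\<^sup>2)\<^sup>2) \<in> borel_measurable borel"
      by (intro borel_measurable_continuous_onI continuous_intros)
    then have "?f \<in> borel_measurable borel"
      by (intro measurable_compose[OF _ measurable_ennreal] borel_measurable_divide borel_measurable_indicator) auto
    then show ?thesis unfolding hyperbolic_volume_def using O by (intro emeasure_density) auto
  qed
  also have "\<dots> = (\<integral>\<^sup>+p. ?g p \<partial>lborel)" by (simp add: eq)
  also have "\<dots> = (\<integral>\<^sup>+x. \<integral>\<^sup>+q. ?g (x, q) \<partial>lborel \<partial>lborel)"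
    by (rule nn_integral_lborel_pair[OF m])
  also have "\<dots> = (\<integral>\<^sup>+x. \<integral>\<^sup>+y. \<integral>\<^sup>+z. ?g (x, y, z) \<partial>lborel \<partial>lborel \<partial>lborel)"
  proof (intro nn_integral_cong nn_integral_lborel_pair)
    fix x :: real
    have "(\<lambda>(y, z). ennreal (octa_density x y z)) \<in> borel_measurable borel"
      unfolding borel_prod[symmetric] by measurable
    then show "(\<lambda>q. ?g (x, q)) \<in> borel_measurable borel" by simp
  qed
  finally show ?thesis by simp
qed

text \<open>The substitution y = x w, with Jacobian |x|, makes w the tangent of the angle around the
  z-axis. With x innermost, the first integrand is x / (B - k x^2)^2, which has a rational
  antiderivative.\<close>

lemma emeasure_octahedron_polar:
  "emeasure hyperbolic_volume regular_ideal_octahedron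
     = (\<integral>\<^sup>+w. \<integral>\<^sup>+z. \<integral>\<^sup>+x. \<bar>x\<bar> * octa_density x (x * w) z \<partial>lborel \<partial>lborel \<partial>lborel)"
proof -
  have step: "(\<integral>\<^sup>+y. \<integral>\<^sup>+z. octa_density x y z \<partial>lborel \<partial>lborel)
      = (\<integral>\<^sup>+w. \<integral>\<^sup>+z. \<bar>x\<bar> * octa_density x (x * w) z \<partial>lborel \<partial>lborel)" if "x \<noteq> 0" for x
  proof -
    have "(\<integral>\<^sup>+y. \<integral>\<^sup>+z. octa_density x y z \<partial>lborel \<partial>lborel)
      = \<bar>x\<bar> * (\<integral>\<^sup>+w. \<integral>\<^sup>+z. octa_density x (0 + x * w) z \<partial>lborel \<partial>lborel)"
      by (rule nn_integral_real_affine) (use that in measurable)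
    also have "\<dots> = (\<integral>\<^sup>+w. \<integral>\<^sup>+z. \<bar>x\<bar> * octa_density x (x * w) z \<partial>lborel \<partial>lborel)"
      by (simp add: nn_integral_cmult ennreal_mult octa_density_nonneg)
    finally show ?thesis .
  qed
  have "emeasure hyperbolic_volume regular_ideal_octahedron
      = (\<integral>\<^sup>+x. \<integral>\<^sup>+w. \<integral>\<^sup>+z. \<bar>x\<bar> * octa_density x (x * w) z \<partial>lborel \<partial>lborel \<partial>lborel)"
    unfolding emeasure_octahedron_cartesian
    by (intro nn_integral_cong_AE eventually_mono[OF AE_lborel_singleton[of "0::real"]] step)
  also have "\<dots> = (\<integral>\<^sup>+w. \<integral>\<^sup>+x. \<integral>\<^sup>+z. \<bar>x\<bar> * octa_density x (x * w) z \<partial>lborel \<partial>lborel \<partial>lborel)"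
    by (rule lborel_pair.Fubini') measurable
  also have "\<dots> = (\<integral>\<^sup>+w. \<integral>\<^sup>+z. \<integral>\<^sup>+x. \<bar>x\<bar> * octa_density x (x * w) z \<partial>lborel \<partial>lborel \<partial>lborel)"
    by (intro nn_integral_cong lborel_pair.Fubini') measurable
  finally show ?thesis .
qed

section \<open>The three integrals over one octant\<close>

lemma octa_inner_integral:
  assumes w: "0 < w" and z: "0 < z"
  shows "(\<integral>\<^sup>+x. ennreal (\<bar>x\<bar> * octa_density x (x * w) z) * indicator {0<..} x \<partial>lborel)
    = ennreal (1 / (4 * (1 + z) * (w + (1 + w + w\<^sup>2) * z))) * indicator {0<..<1} z"
proof (cases "z < 1")
  case False
  have e: "ennreal (\<bar>x\<bar> * octa_density x (x * w) z) * indicator {0<..} x = 0" for x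
    using False w by (auto simp: octa_density_def split: split_indicator)
  show ?thesis unfolding e using False by simp
next
  case True
  \<comment> \<open>For positive variables the face condition x + x w + z <= 1 reads x <= M, and 1 -
    |p|^2 becomes B - k x^2.\<close>
  define M B k where "M = (1 - z) / (1 + w)" "B = 1 - z\<^sup>2" "k = 1 + w\<^sup>2"
  note defs = this
  have k: "0 < k" by (simp add: defs add_pos_nonneg)
  have M: "0 < M" using w True by (simp add: defs)
  have kM: "k * M\<^sup>2 \<le> (1 - z)\<^sup>2"
  proof -
    have "k \<le> (1 + w)\<^sup>2" using w by (simp add: defs power2_sum)
    then have "k * M\<^sup>2 \<le> (1 + w)\<^sup>2 * M\<^sup>2" by (intro mult_right_mono) auto
    also have "\<dots> = ((1 + w) * M)\<^sup>2" by (simp add: power_mult_distrib)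
    also have "(1 + w) * M = 1 - z" using w by (simp add: defs)
    finally show ?thesis .
  qed
  have z2: "(1 - z)\<^sup>2 < B" using z True by (simp add: defs power2_eq_square algebra_simps)
  have pos: "0 < B - k * x\<^sup>2" if "0 \<le> x" "x \<le> M" for x
  proof -
    have "k * x\<^sup>2 \<le> k * M\<^sup>2" using that k by (intro mult_left_mono power_mono) auto
    then show ?thesis using kM z2 by linarith
  qed
  let ?f = "\<lambda>x. x / (B - k * x\<^sup>2)\<^sup>2"
  let ?F = "\<lambda>x. 1 / (2 * k * (B - k * x\<^sup>2))"
  have "(\<integral>\<^sup>+x. ennreal (\<bar>x\<bar> * octa_density x (x * w) z) * indicator {0<..} x \<partial>lborel)
      = (\<integral>\<^sup>+x. ennreal (?f x) * indicator {0..M} x \<partial>lborel)"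
  proof (intro nn_integral_cong)
    fix x :: real
    consider "x < 0" | "x = 0" | "0 < x" by linarith
    then show "ennreal (\<bar>x\<bar> * octa_density x (x * w) z) * indicator {0<..} x = ennreal (?f x) * indicator {0..M} x"
    proof cases
      case 3
      have "0 < x * w" using 3 w by simp
      then have "\<bar>x\<bar> + \<bar>x * w\<bar> + \<bar>z\<bar> = x + x * w + z" using 3 z by simp
      moreover have "x + x * w + z \<le> 1 \<longleftrightarrow> x \<le> M" using w by (simp add: defs field_simps)
      moreover have "1 - (x\<^sup>2 + (x * w)\<^sup>2 + z\<^sup>2) = B - k * x\<^sup>2"
        by (simp add: defs power_mult_distrib algebra_simps)
      ultimately have "octa_density x (x * w) z = (if x \<le> M then 1 / (B - k * x\<^sup>2)\<^sup>2 else 0)"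
        by (simp only: octa_density_def)
      then show ?thesis using 3 by simp
    qed simp_all
  qed
  also have "\<dots> = ennreal (?F M - ?F 0)"
  proof (rule nn_integral_FTC_Icc)
    fix x assume "x \<in> {0..M}"
    then have p: "0 < B - k * x\<^sup>2" "0 \<le> x" using pos by auto
    have F: "?F = (\<lambda>x. 1 / (2 * k) * inverse (B - k * x\<^sup>2))"
      by (simp add: inverse_eq_divide)
    have e: "1 / (2 * k) * - (inverse P * (- (k * (2 * x))) * inverse P) = x / P\<^sup>2" for P
      using k by (simp add: field_simps power2_eq_square)
    have "((\<lambda>x. B - k * x\<^sup>2) has_real_derivative - (k * (2 * x))) (at x)"
      by (auto intro!: derivative_eq_intros)
    from DERIV_cmult[OF DERIV_inverse'[OF this], of "1 / (2 * k)"] p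
    show "(?F has_real_derivative ?f x) (at x)"
      unfolding F e by simp
    show "0 \<le> ?f x" using p by simp
  qed (use M in auto)
  also have "?F M - ?F 0 = 1 / (4 * (1 + z) * (w + (1 + w + w\<^sup>2) * z))"
  proof -
    have B: "B = (1 - z) * (1 + z)" by (simp add: defs power2_eq_square algebra_simps)
    define D where "D = w + (1 + w + w\<^sup>2) * z"
    have D: "0 < D" using w z by (simp add: D_def add_pos_pos)
    \<comment> \<open>The factor 1 - z here and the one in B cancel against those of M^2, so nothing
      singular remains at the ideal vertex z = 1.\<close>
    have BM: "B - k * M\<^sup>2 = 2 * (1 - z) * D / (1 + w)\<^sup>2"
      using w by (simp add: defs D_def power_divide field_simps) algebra
    have "?F M - ?F 0 = (k * M\<^sup>2) / (2 * k * (B - k * M\<^sup>2) * B)"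
      using pos[of M] pos[of 0] M k by (simp add: field_simps)
    also have "\<dots> = M\<^sup>2 / (2 * (B - k * M\<^sup>2) * B)" using k by simp
    also have "\<dots> = 1 / (4 * (1 + z) * D)"
    proof -
      have M2: "M\<^sup>2 = (1 - z)\<^sup>2 / (1 + w)\<^sup>2" by (simp add: defs power_divide)
      have gen: "a\<^sup>2 / c\<^sup>2 / (2 * (2 * a * D / c\<^sup>2) * (a * b)) = 1 / (4 * b * D)"
        if "0 < a" "0 < b" "0 < c" for a b c
        using that D by (simp add: field_simps power2_eq_square)
      have "0 < 1 - z" "0 < 1 + z" "0 < 1 + w" using w z True by auto
      from gen[OF this, folded M2 BM B] show ?thesis .
    qed
    finally show ?thesis by (simp add: D_def)
  qed
  finally show ?thesis using True z by simp
qed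

lemma octa_middle_integral:
  assumes w: "0 < w"
  shows "(\<integral>\<^sup>+z. ennreal (1 / (4 * (1 + z) * (w + (1 + w + w\<^sup>2) * z))) * indicator {0<..<1} z \<partial>lborel)
    = ennreal (ln ((1 + w)\<^sup>2 / (2 * w)) / (4 * (1 + w\<^sup>2)))"
proof -
  define D k where "D = 1 + w + w\<^sup>2" "k = 1 + w\<^sup>2"
  note defs = this
  have k: "0 < k" "0 < D" using w by (auto simp: defs add_pos_nonneg)
  let ?f = "\<lambda>z. 1 / (4 * (1 + z) * (w + D * z))"
  let ?F = "\<lambda>z. (ln (w + D * z) - ln (1 + z)) / (4 * k)"
  have "(\<integral>\<^sup>+z. ennreal (?f z) * indicator {0<..<1} z \<partial>lborel) = (\<integral>\<^sup>+z. ennreal (?f z) * indicator {0..1} z \<partial>lborel)"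
    using AE_lborel_singleton[of "0::real"] AE_lborel_singleton[of "1::real"]
    by (intro nn_integral_cong_AE) (auto split: split_indicator elim!: eventually_elim2)
  also have "\<dots> = ennreal (?F 1 - ?F 0)"
  proof (rule nn_integral_FTC_Icc)
    fix z :: real assume z: "z \<in> {0..1}"
    have p: "0 < w + D * z" "0 < 1 + z" using z w k by (auto intro!: add_pos_nonneg)
    have "(?F has_real_derivative (D / (w + D * z) - 1 / (1 + z)) / (4 * k)) (at z)"
      using p by (intro DERIV_cdivide) (auto intro!: derivative_eq_intros simp: divide_inverse)
    also have "(D / (w + D * z) - 1 / (1 + z)) / (4 * k) = ?f z"
    proof -
      \<comment> \<open>Partial fractions, with D - w = k.\<close>
      have e: "D / (w + D * z) - 1 / (1 + z) = k / ((1 + z) * (w + D * z))"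
        using p by (simp add: divide_simps) (simp add: defs algebra_simps)
      have "k / P / (4 * k) = 1 / (4 * P)" for P using k by simp
      then show ?thesis unfolding e by (simp only: mult.assoc)
    qed
    finally show "(?F has_real_derivative ?f z) (at z)" .
    show "0 \<le> ?f z" using p by simp
  qed auto
  also have "?F 1 - ?F 0 = ln ((1 + w)\<^sup>2 / (2 * w)) / (4 * k)"
  proof -
    have "w + D = (1 + w)\<^sup>2" by (simp add: defs power2_sum)
    then show ?thesis using w by (simp add: ln_div ln_mult diff_divide_distrib add_divide_distrib)
  qed
  finally show ?thesis by (simp add: defs)
qed

text \<open>With w = tan \<theta>, the argument of ln is (2 sin (\<theta> + pi / 4))^2 / (2 sin (2
  \<theta>)), so \<open>lob\<close> provides the antiderivative \<psi> in the angle. The value is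
  the volume of one octant.\<close>

lemma octa_outer_integral:
  "(\<integral>\<^sup>+w. ennreal (ln ((1 + w)\<^sup>2 / (2 * w)) / (4 * (1 + w\<^sup>2))) * indicator {0<..} w \<partial>lborel) = ennreal (lob (pi / 4))"
proof -
  define f where "f w = ln ((1 + w)\<^sup>2 / (2 * w)) / (4 * (1 + w\<^sup>2))" for w :: real
  define \<psi> where "\<psi> \<theta> = (lob (2 * \<theta>) / 2 - 2 * lob (\<theta> + pi / 4)) / 4" for \<theta>
  define F where "F w = \<psi> (arctan w)" for w
  have D: "(F has_real_derivative f w) (at w)" if w: "0 < w" for w
  proof -
    define \<theta> where "\<theta> = arctan w"
    have \<theta>: "0 < \<theta>" "\<theta> < pi / 2" using w arctan_ubound by (auto simp: \<theta>_def)
    have s: "sin (2 * \<theta>) > 0" "sin (\<theta> + pi / 4) > 0" using \<theta> by (auto intro!: sin_gt_zero)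
    define R where "R = sqrt (1 + w\<^sup>2)"
    have R: "0 < R" "R\<^sup>2 = 1 + w\<^sup>2" by (auto simp: R_def add_pos_nonneg)
    have sc: "sin \<theta> = w / R" "cos \<theta> = 1 / R" by (simp_all add: \<theta>_def R_def sin_arctan cos_arctan)
    have "sin (\<theta> + pi / 4) = (1 + w) / R * (sqrt 2 / 2)"
      by (simp add: sin_add sc sin_45 cos_45 add_divide_distrib distrib_right)
    then have e1: "(2 * sin (\<theta> + pi / 4))\<^sup>2 = 2 * (1 + w)\<^sup>2 / R\<^sup>2"
      by (simp add: power_mult_distrib power_divide)
    have e2: "2 * sin (2 * \<theta>) = 4 * w / R\<^sup>2"
      by (simp add: sin_double sc power2_eq_square)
    have "(2 * sin (\<theta> + pi / 4))\<^sup>2 / (2 * sin (2 * \<theta>)) = (1 + w)\<^sup>2 / (2 * w)"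
      unfolding e1 e2 using R(1) w by simp
    then have "ln ((1 + w)\<^sup>2 / (2 * w)) = ln ((2 * sin (\<theta> + pi / 4))\<^sup>2 / (2 * sin (2 * \<theta>)))" by simp
    also have "\<dots> = 2 * ln (2 * sin (\<theta> + pi / 4)) - ln (2 * sin (2 * \<theta>))"
    proof -
      have "ln (a\<^sup>2 / b) = 2 * ln a - ln b" if "0 < a" "0 < b" for a b :: real
        using that by (simp add: ln_div ln_realpow)
      from this[of "2 * sin (\<theta> + pi / 4)" "2 * sin (2 * \<theta>)"] s
      show ?thesis by (simp only: mult_pos_pos zero_less_numeral)
    qed
    finally have e: "(2 * ln \<bar>2 * sin (\<theta> + pi / 4)\<bar> - ln \<bar>2 * sin (2 * \<theta>)\<bar>) / 4 = ln ((1 + w)\<^sup>2 / (2 * w)) / 4"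
      using s by simp
    have "(\<psi> has_real_derivative (2 * ln \<bar>2 * sin (\<theta> + pi / 4)\<bar> - ln \<bar>2 * sin (2 * \<theta>)\<bar>) / 4) (at (arctan w))"
      unfolding \<psi>_def using s by (auto intro!: derivative_eq_intros simp: \<theta>_def)
    from DERIV_chain2[OF this[unfolded e] DERIV_arctan]
    show ?thesis unfolding F_def f_def by (simp add: field_simps)
  qed
  have nn: "0 \<le> f w" if "0 < w" for w
  proof -
    have "2 * w \<le> (1 + w)\<^sup>2" by (simp add: power2_sum)
    then have "1 \<le> (1 + w)\<^sup>2 / (2 * w)" using that by simp
    then show ?thesis by (simp add: f_def)
  qed
  have c\<psi>: "isCont \<psi> t" for t
  proof -
    have "continuous_on UNIV \<psi>" unfolding \<psi>_def by (intro continuous_intros) auto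
    then show ?thesis by (simp add: continuous_on_eq_continuous_at)
  qed
  have lim0: "((F \<circ> real_of_ereal) \<longlongrightarrow> \<psi> 0) (at_right 0)"
  proof -
    have "isCont F 0" unfolding F_def
      by (rule isCont_o2[OF isCont_arctan c\<psi>])
    then have "(F \<longlongrightarrow> \<psi> 0) (at_right 0)" by (simp add: isCont_def filterlim_at_split F_def)
    then show ?thesis by (simp add: zero_ereal_def ereal_tendsto_simps)
  qed
  have lim1: "((F \<circ> real_of_ereal) \<longlongrightarrow> \<psi> (pi / 2)) (at_left \<infinity>)"
  proof -
    have "(F \<longlongrightarrow> \<psi> (pi / 2)) at_top" unfolding F_def
      by (rule isCont_tendsto_compose[OF c\<psi> tendsto_arctan_at_top])
    then show ?thesis by (simp add: ereal_tendsto_simps)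
  qed
  have ei: "einterval 0 \<infinity> = {0<..}" by (auto simp: einterval_def)
  have cf: "isCont f w" if "0 < w" for w
  proof -
    have "0 < 1 + w\<^sup>2" by (simp add: add_pos_nonneg)
    then show ?thesis unfolding f_def[abs_def] using that by (intro continuous_intros) auto
  qed
  \<comment> \<open>Nonnegativity and the limits of the antiderivative at 0 and infinity yield
    integrability along with the value.\<close>
  have "set_integrable lborel (einterval 0 \<infinity>) f" "(LBINT w=0..\<infinity>. f w) = \<psi> (pi / 2) - \<psi> 0"
    by (rule interval_integral_FTC_nonneg[of 0 \<infinity> F f, OF _ _ _ _ lim0 lim1];
        use nn D cf in \<open>auto simp: zero_ereal_def\<close>)+
  then have I: "integrable lborel (\<lambda>w. indicator {0<..} w * f w)" 
     "(LINT w|lborel. indicator {0<..} w * f w) = \<psi> (pi / 2) - \<psi> 0"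
    by (simp_all add: set_integrable_def interval_lebesgue_integral_def set_lebesgue_integral_def ei)
  have "lob (3 * pi / 4) = - lob (pi / 4)"
    using lob_pi_minus[of "pi / 4"] by (simp add: field_simps)
  then have "\<psi> (pi / 2) - \<psi> 0 = lob (pi / 4)"
    using lob_pi by (simp add: \<psi>_def field_simps)
  moreover have "(\<integral>\<^sup>+w. ennreal (indicator {0<..} w * f w) \<partial>lborel) = ennreal (\<psi> (pi / 2) - \<psi> 0)"
    using nn_integral_eq_integral[OF I(1)] I(2) nn by (auto split: split_indicator)
  moreover have "ennreal (indicator {0<..} w * f w) = ennreal (f w) * indicator {0<..} w" for w
    by (simp split: split_indicator)
  ultimately show ?thesis by (simp add: f_def)
qed

lemma v8_eq: "v8 = 8 * lob (pi / 4)"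
proof -
  let ?k = "\<lambda>w z x. ennreal (\<bar>x\<bar> * octa_density x (x * w) z)"
  have even: "octa_density (- x) y z = octa_density x y z" "octa_density x (- y) z = octa_density x y z"
    "octa_density x y (- z) = octa_density x y z" for x y z
    by (simp_all add: octa_density_def)
  define P where "P = (\<lambda>w z. \<integral>\<^sup>+x. ?k w z x * indicator {0<..} x \<partial>lborel)"
  define S where "S = (\<lambda>w. \<integral>\<^sup>+z. P w z * indicator {0<..} z \<partial>lborel)"
  have mP [measurable]: "(\<lambda>z. P w z) \<in> borel_measurable borel" for w unfolding P_def by measurable
  have mS [measurable]: "S \<in> borel_measurable borel" unfolding S_def P_def by measurable
  have "emeasure hyperbolic_volume regular_ideal_octahedron = (\<integral>\<^sup>+w. \<integral>\<^sup>+z. 2 * P w z \<partial>lborel \<partial>lborel)"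
    unfolding emeasure_octahedron_polar P_def
    by (intro nn_integral_cong nn_integral_even) (auto simp: even)
  also have "\<dots> = (\<integral>\<^sup>+w. 2 * (2 * S w) \<partial>lborel)"
  proof (rule nn_integral_cong)
    fix w
    have "(\<integral>\<^sup>+z. P w z \<partial>lborel) = 2 * S w"
      unfolding S_def by (rule nn_integral_even) (auto simp: P_def even)
    then show "(\<integral>\<^sup>+z. 2 * P w z \<partial>lborel) = 2 * (2 * S w)" by (simp add: nn_integral_cmult)
  qed
  also have "\<dots> = 4 * (\<integral>\<^sup>+w. S w \<partial>lborel)"
    by (subst nn_integral_cmult[symmetric]) (auto simp: mult.assoc[symmetric])
  also have "(\<integral>\<^sup>+w. S w \<partial>lborel) = 2 * (\<integral>\<^sup>+w. S w * indicator {0<..} w \<partial>lborel)"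
    by (rule nn_integral_even) (auto simp: S_def P_def even)
  also have "(\<integral>\<^sup>+w. S w * indicator {0<..} w \<partial>lborel)
     = (\<integral>\<^sup>+w. ennreal (ln ((1 + w)\<^sup>2 / (2 * w)) / (4 * (1 + w\<^sup>2))) * indicator {0<..} w \<partial>lborel)"
  proof (rule nn_integral_cong)
    fix w :: real
    show "S w * indicator {0<..} w = ennreal (ln ((1 + w)\<^sup>2 / (2 * w)) / (4 * (1 + w\<^sup>2))) * indicator {0<..} w"
    proof (cases "0 < w")
      case True
      have "P w z * indicator {0<..} z
          = ennreal (1 / (4 * (1 + z) * (w + (1 + w + w\<^sup>2) * z))) * indicator {0<..<1} z" for z
        using octa_inner_integral[OF True, of z]
        by (cases "0 < z") (auto simp: P_def)
      then have "S w = ennreal (ln ((1 + w)\<^sup>2 / (2 * w)) / (4 * (1 + w\<^sup>2)))"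
        unfolding S_def using octa_middle_integral[OF True] by simp
      then show ?thesis by simp
    qed simp
  qed
  also have "\<dots> = ennreal (lob (pi / 4))" by (rule octa_outer_integral)
  finally have "emeasure hyperbolic_volume regular_ideal_octahedron = ennreal (8 * lob (pi / 4))"
    using lob_nonneg[of "pi / 4"] by (simp add: ennreal_mult mult.assoc[symmetric])
  then show ?thesis
    using lob_nonneg[of "pi / 4"] by (simp add: v8_def measure_def)
qed

section \<open>The growth bound\<close>

theorem theorem1p2:
  shows "\<exists>C :: real. \<exists>r0 :: nat. \<forall>r n1 n2 n3 n4 n5 n6 :: nat.
           odd r \<and> r \<ge> 3 \<and> r > r0 \<and> admissible r n1 n2 n3 n4 n5 n6 \<longrightarrow>
             ereal (2 * pi / real r) * elog (cmod (quantum_6j r n1 n2 n3 n4 n5 n6))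
               \<le> ereal (v8 + C * (ln (real r) / real r))"
proof (intro exI allI impI)
  fix r n1 n2 n3 n4 n5 n6 :: nat
  \<comment> \<open>An odd r above 6 is at least 7. The constant is 40 times the factor 2 pi of the
    normalisation.\<close>
  assume "odd r \<and> r \<ge> 3 \<and> r > 6 \<and> admissible r n1 n2 n3 n4 n5 n6"
  then show "ereal (2 * pi / real r) * elog (cmod (quantum_6j r n1 n2 n3 n4 n5 n6))
               \<le> ereal (v8 + (80 * pi) * (ln (real r) / real r))"
    unfolding v8_eq by (intro quantum_6j_log_le) auto
qed

end
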